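(* Given a data size $n$, suppose $\mathcal Y=\mathbb R^k$ and $\mathbb P_{\hat\theta}$ admits a density, where $\hat\theta=\hat\theta_n$ is the maximum likelihood estimator. Let $$\delta_\epsilon=\epsilon'\Big(\epsilon,\ \frac{\phi''(1)\chi^2_{1-\alpha,D}}{2n},\ \phi\Big)$$ (assumed positive), draw $N=N_{exact}(\delta_\epsilon,\beta,d)$ i.i.d. Monte Carlo samples $\xi_1^{MC},\dots,\xi_N^{MC}$ from the generating distribution $\mathbb P_{\hat\theta}$ (conditionally on the data), and let $\hat x^{MC}$ be the solution of $$\min_{x\in\mathcal X}\ c^Tx\quad\text{s.t.}\quad x\in\mathcal X_{\xi_i^{MC}},\ i=1,\dots,N .$$ Then $\hat x^{MC}$ is feasible for $$\min_{x\in\mathcal X}\ c^Tx\quad\text{s.t.}\quad \mathbb P_{\theta_{true}}(x\in\mathcal X_\xi)\ge 1-\epsilon$$ with asymptotic confidence level at least $1-\alpha-\beta$; that is, the $\liminf$ as $n\to\infty$ of the probability (over data and Monte Carlo samples) that $\hat x^{MC}$ is feasible is at least $1-\alpha-\beta$.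
   Context: Problem data: $\mathcal X\subseteq\mathbb R^d$, $c\in\mathbb R^d$, and $\mathcal X_\xi\subseteq\mathcal X$ for each $\xi\in\mathcal Y$. Standing assumptions: $\mathcal X_\xi$ is convex for every $\xi$, and every instance of the sampled problem has a feasible region with nonempty interior and a unique optimal solution. $\epsilon,\alpha,\beta\in(0,1)$. The data $\xi_1,\dots,\xi_n$ are i.i.d. from $\mathbb P_{\theta_{true}}$, a member of a parametric family $\mathcal P_{para}=\{\mathbb P_\theta\}_{\theta\in\Theta}$, $\Theta\subset\mathbb R^D$; $\mathbb P_{data}$ is the law of the data. Assumption on the MLE $\hat\theta_n$ of $\theta_{true}$: as $n\to\infty$, $\hat\theta_n\to\theta_{true}$ in probability and $\sqrt n(\hat\theta_n-\theta_{true})\to\mathcal N(0,\mathcal I^{-1}(\theta_{true}))$ in distribution, where $\mathcal I(\theta)$ is the Fisher information, with well-defined inverse continuous on $\Theta$. $\phi:\mathbb R_+\to\mathbb R_+$ is convex with $\phi(1)=0$, twice continuously differentiable with $\phi''(1)\ne0$, extended by $\phi(x)=+\infty$ for $x<0$; $d_\phi(\mathbb P_1,\mathbb P_2)=\int\phi(\frac{d\mathbb P_2}{d\mathbb P_1})d\mathbb P_1$ for $\mathbb P_2\ll\mathbb P_1$. $\chi^2_{1-\alpha,D}$ is the $1-\alpha$ quantile of the $\chi^2$-distribution with $D$ degrees of freedom. Let $$\mathcal U_{data}=\Big\{\mathbb Q\in\mathcal P_{para}: d_\phi(\mathbb P_{\hat\theta_n},\mathbb Q)\le\frac{\phi''(1)\chi^2_{1-\alpha,D}}{2n}\Big\}.$$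 The paper takes as known from the literature that, under the MLE assumption, $\lim_{n\to\infty}\mathbb P_{data}(\mathbb P_{\theta_{true}}\in\mathcal U_{data})=1-\alpha$; this is used as a standing fact. $$N_{exact}(\epsilon,\beta,d)=\min\Big\{n:\ \sum_{i=0}^{d-1}\binom ni\epsilon^i(1-\epsilon)^{n-i}\le\beta\Big\}.$$ Let $\phi^*(t)=\sup_x\{tx-\phi(x)\}$, $\underline m(\phi^* )=\sup\{m\in\mathbb R:\phi^*\text{ is a finite constant on }(-\infty,m]\}$ (with $\sup\emptyset=-\infty$), $\overline m(\phi^* )=\inf\{m\in\mathbb R:\phi^*(m)=+\infty\}$ (with $\inf\emptyset=+\infty$). For $0\le\epsilon<1$ and $\lambda>0$, $$\epsilon'(\epsilon,\lambda,\phi)=\max\left\{1-\inf_{\substack{z_0\in\mathbb R,\ z>0\\ \underline m(\phi^* )\le z_0+z\le\overline m(\phi^* )}}\frac{\phi^*(z_0+z)-z_0-\epsilon z+\lambda}{\phi^*(z_0+z)-\phi^*(z_0)},\ 0\right\},$$ where a quotient with zero denominator is read as $+\infty$ and only points with $\phi^*(z_0+z)<\infty$ are considered. *)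

theory Defs
  imports "HOL-Probability.Probability"
begin

section \<open>Divergences and the adjusted tolerance\<close>

text \<open>The generator \<open>\<phi>\<close> is only meaningful on \<open>{0..}\<close>; it is extended by \<open>\<infinity>\<close> to the
  negative half-line.\<close>

definition phi_ext :: "(real \<Rightarrow> real) \<Rightarrow> real \<Rightarrow> ereal" where
  "phi_ext \<phi> x = (if x < 0 then \<infinity> else ereal (\<phi> x))"

definition phi_conj :: "(real \<Rightarrow> real) \<Rightarrow> real \<Rightarrow> ereal" where
  "phi_conj \<phi> t = (SUP x. ereal (t * x) - phi_ext \<phi> x)"

text \<open>Twice continuous differentiability is required on the open half-line only, so that
  generators such as \<open>x ln x - x + 1\<close>, which have no derivative at 0, are covered.\<close>

definition phi_generator :: "(real \<Rightarrow> real) \<Rightarrow> bool" where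
  "phi_generator \<phi> \<longleftrightarrow>
     convex_on {0..} \<phi> \<and> (\<forall>x\<ge>0. 0 \<le> \<phi> x) \<and> \<phi> 1 = 0 \<and>
     (\<forall>x>0. \<phi> differentiable (at x)) \<and>
     (\<forall>x>0. deriv \<phi> differentiable (at x)) \<and>
     continuous_on {0<..} (deriv (deriv \<phi>)) \<and>
     deriv (deriv \<phi>) 1 \<noteq> 0"

text \<open>The divergence \<open>d\<^sub>\<phi>(P\<^sub>1, P\<^sub>2)\<close>; meaningful when \<open>P\<^sub>2\<close> is absolutely continuous
  with respect to \<open>P\<^sub>1\<close>.\<close>

definition phi_div :: "(real \<Rightarrow> real) \<Rightarrow> 'a measure \<Rightarrow> 'a measure \<Rightarrow> ennreal" where
  "phi_div \<phi> P1 P2 = (\<integral>\<^sup>+x. ennreal (\<phi> (enn2real (RN_deriv P1 P2 x))) \<partial>P1)"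

definition m_lower :: "(real \<Rightarrow> real) \<Rightarrow> ereal" where
  "m_lower \<phi> = Sup (ereal ` {m. \<exists>a::real. \<forall>t\<le>m. phi_conj \<phi> t = ereal a})"

definition m_upper :: "(real \<Rightarrow> real) \<Rightarrow> ereal" where
  "m_upper \<phi> = Inf (ereal ` {m. phi_conj \<phi> m = \<infinity>})"

definition eps_quotient ::
  "real \<Rightarrow> real \<Rightarrow> (real \<Rightarrow> real) \<Rightarrow> real \<Rightarrow> real \<Rightarrow> ereal" where
  "eps_quotient \<epsilon> l \<phi> z0 z =
     (let num = phi_conj \<phi> (z0 + z) - ereal z0 - ereal (\<epsilon> * z) + ereal l;
          den = phi_conj \<phi> (z0 + z) - phi_conj \<phi> z0
      in if den = 0 then \<infinity> else num / den)"

text \<open>For a generator \<open>\<phi>\<close>, \<open>0 \<le> \<epsilon> < 1\<close> and \<open>l > 0\<close> all quotients are nonnegative, since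
  \<open>\<phi>\<^sup>*(z0 + z) \<ge> z0 + z\<close> and \<open>\<phi>\<^sup>*\<close> is nondecreasing. So the maximum below lies in
  \<open>[0, 1]\<close> and nothing is lost by \<^const>\<open>real_of_ereal\<close>.\<close>

definition eps_adjusted :: "real \<Rightarrow> real \<Rightarrow> (real \<Rightarrow> real) \<Rightarrow> real" where
  "eps_adjusted \<epsilon> l \<phi> =
     real_of_ereal (max
       (1 - Inf {eps_quotient \<epsilon> l \<phi> z0 z | z0 z.
                   0 < z \<and> m_lower \<phi> \<le> ereal (z0 + z) \<and> ereal (z0 + z) \<le> m_upper \<phi> \<and>
                   phi_conj \<phi> (z0 + z) < \<infinity>})
       0)"


section \<open>Sample sizes and calibration\<close>

definition N_exact :: "real \<Rightarrow> real \<Rightarrow> nat \<Rightarrow> nat" where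
  "N_exact \<epsilon> \<beta> d =
     (LEAST n. (\<Sum>i<d. real (n choose i) * \<epsilon> ^ i * (1 - \<epsilon>) ^ (n - i)) \<le> \<beta>)"

definition chi_square :: "nat \<Rightarrow> real measure" where
  "chi_square D =
     distr (\<Pi>\<^sub>M i\<in>{..<D}. density lborel (\<lambda>x. ennreal (std_normal_density x))) borel
       (\<lambda>x. \<Sum>i<D. (x i)\<^sup>2)"

definition quantile :: "real measure \<Rightarrow> real \<Rightarrow> real" where
  "quantile M q = Inf {x. q \<le> cdf M x}"

definition div_radius :: "(real \<Rightarrow> real) \<Rightarrow> real \<Rightarrow> nat \<Rightarrow> nat \<Rightarrow> real" where
  "div_radius \<phi> \<alpha> D n =
     deriv (deriv \<phi>) 1 * quantile (chi_square D) (1 - \<alpha>) / (2 * real n)"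

definition U_data ::
  "(real \<Rightarrow> real) \<Rightarrow> real \<Rightarrow> nat \<Rightarrow> (real^'p \<Rightarrow> 'a measure) \<Rightarrow> (real^'p) set \<Rightarrow> real^'p
    \<Rightarrow> 'a measure set" where
  "U_data \<phi> \<alpha> n P \<Theta> \<theta>hat =
     {Q \<in> P ` \<Theta>. absolutely_continuous (P \<theta>hat) Q \<and>
        phi_div \<phi> (P \<theta>hat) Q \<le> ennreal (div_radius \<phi> \<alpha> CARD('p) n)}"


section \<open>Maximum likelihood\<close>

text \<open>\<open>p \<theta>\<close> is the density of the member with parameter \<open>\<theta>\<close> relative to a common
  dominating measure.\<close>

definition score ::
  "(real^'p \<Rightarrow> 'a \<Rightarrow> real) \<Rightarrow> (real^'p) set \<Rightarrow> real^'p \<Rightarrow> 'a \<Rightarrow> real^'p" where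
  "score p \<Theta> \<theta> x =
     (\<chi> i. frechet_derivative (\<lambda>\<theta>'. ln (p \<theta>' x)) (at \<theta> within \<Theta>) (axis i 1))"

definition fisher_information ::
  "(real^'p \<Rightarrow> 'a measure) \<Rightarrow> (real^'p \<Rightarrow> 'a \<Rightarrow> real) \<Rightarrow> (real^'p) set
    \<Rightarrow> real^'p \<Rightarrow> real^'p^'p" where
  "fisher_information P p \<Theta> \<theta> =
     (\<chi> i j. \<integral>x. score p \<Theta> \<theta> x $ i * score p \<Theta> \<theta> x $ j \<partial>P \<theta>)"

definition has_fisher_information ::
  "(real^'p \<Rightarrow> 'a measure) \<Rightarrow> (real^'p \<Rightarrow> 'a \<Rightarrow> real) \<Rightarrow> (real^'p) set
    \<Rightarrow> real^'p \<Rightarrow> bool" where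
  "has_fisher_information P p \<Theta> \<theta> \<longleftrightarrow>
     (AE x in P \<theta>. (\<lambda>\<theta>'. ln (p \<theta>' x)) differentiable (at \<theta> within \<Theta>)) \<and>
     (\<forall>i j. integrable (P \<theta>) (\<lambda>x. score p \<Theta> \<theta> x $ i * score p \<Theta> \<theta> x $ j))"

text \<open>Centred normal law with nonsingular covariance matrix.\<close>

definition centred_normal :: "real^'p^'p \<Rightarrow> (real^'p) measure" where
  "centred_normal S =
     density lborel (\<lambda>x. ennreal (exp (- (x \<bullet> (matrix_inv S *v x)) / 2)
                                  / sqrt ((2 * pi) ^ CARD('p) * det S)))"

definition conv_in_distribution ::
  "(nat \<Rightarrow> 'w measure) \<Rightarrow> (nat \<Rightarrow> 'w \<Rightarrow> 'b::topological_space) \<Rightarrow> 'b measure \<Rightarrow> bool" where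
  "conv_in_distribution M Y L \<longleftrightarrow>
     (\<forall>f :: 'b \<Rightarrow> real. continuous_on UNIV f \<and> bounded (range f) \<longrightarrow>
        (\<lambda>n. \<integral>w. f (Y n w) \<partial>M n) \<longlonglongrightarrow> (\<integral>y. f y \<partial>L))"

definition conv_in_probability ::
  "(nat \<Rightarrow> 'w measure) \<Rightarrow> (nat \<Rightarrow> 'w \<Rightarrow> 'b::metric_space) \<Rightarrow> 'b \<Rightarrow> bool" where
  "conv_in_probability M Y y \<longleftrightarrow>
     (\<forall>e>0. (\<lambda>n. measure (M n) {w \<in> space (M n). e < dist (Y n w) y}) \<longlonglongrightarrow> 0)"

text \<open>Samples of size \<open>n\<close> are functions on \<open>{..<n}\<close>. With \<open>Q = borel\<close> this serves only as the
  measurable space of such samples.\<close>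

definition iid :: "nat \<Rightarrow> 'a measure \<Rightarrow> (nat \<Rightarrow> 'a) measure" where
  "iid n Q = (\<Pi>\<^sub>M i\<in>{..<n}. Q)"

definition is_mle ::
  "(real^'p \<Rightarrow> 'a \<Rightarrow> real) \<Rightarrow> (real^'p) set \<Rightarrow> nat \<Rightarrow> (nat \<Rightarrow> 'a) \<Rightarrow> real^'p \<Rightarrow> bool" where
  "is_mle p \<Theta> n \<xi> \<theta>hat \<longleftrightarrow>
     \<theta>hat \<in> \<Theta> \<and> (\<forall>\<theta>\<in>\<Theta>. (\<Prod>i<n. p \<theta> (\<xi> i)) \<le> (\<Prod>i<n. p \<theta>hat (\<xi> i)))"


section \<open>Sampled and chance-constrained problems\<close>

definition sampled_region ::
  "'x set \<Rightarrow> ('a \<Rightarrow> 'x set) \<Rightarrow> nat \<Rightarrow> (nat \<Rightarrow> 'a) \<Rightarrow> 'x set" where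
  "sampled_region X Xc N s = {x \<in> X. \<forall>i<N. x \<in> Xc (s i)}"

definition sampled_solution ::
  "'x::real_inner \<Rightarrow> 'x set \<Rightarrow> ('a \<Rightarrow> 'x set) \<Rightarrow> nat \<Rightarrow> (nat \<Rightarrow> 'a) \<Rightarrow> 'x" where
  "sampled_solution c X Xc N s = arg_min (\<lambda>x. c \<bullet> x) (\<lambda>x. x \<in> sampled_region X Xc N s)"

definition chance_feasible ::
  "'x set \<Rightarrow> ('a \<Rightarrow> 'x set) \<Rightarrow> 'a measure \<Rightarrow> real \<Rightarrow> 'x set" where
  "chance_feasible X Xc Q \<epsilon> = {x \<in> X. measure Q {\<xi> \<in> space Q. x \<in> Xc \<xi>} \<ge> 1 - \<epsilon>}"

text \<open>Joint law of the data \<open>\<xi>\<close> (\<open>n\<close> i.i.d. draws from \<open>Q\<close>) and of \<open>N\<close> Monte Carlo samples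
  that, conditionally on \<open>\<xi>\<close>, are i.i.d. from \<open>K \<xi>\<close>.\<close>

definition data_mc_law ::
  "nat \<Rightarrow> nat \<Rightarrow> 'a::topological_space measure \<Rightarrow> ((nat \<Rightarrow> 'a) \<Rightarrow> 'a measure)
    \<Rightarrow> ((nat \<Rightarrow> 'a) \<times> (nat \<Rightarrow> 'a)) measure" where
  "data_mc_law n N Q K =
     iid n Q \<bind> (\<lambda>\<xi>. distr (iid N (K \<xi>)) (iid n borel \<Otimes>\<^sub>M iid N borel) (\<lambda>s. (\<xi>, s)))"

end

theory Submission
  imports Defs
begin

text \<open>If \<open>P \<theta>true\<close> lies in \<open>U_data\<close>, Fenchel duality shows that a point violating the chance
  constraint under \<open>P \<theta>true\<close> has violation probability at least \<open>\<delta> n\<close> under \<open>P (\<theta>hat n \<xi>)\<close>. So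
  the claim reduces to the scenario bound of Campi and Garatti for the Monte Carlo samples: the
  solution has violation probability at least \<open>\<delta>\<close> with probability at most
  \<open>\<Sum>i<d. (N choose i) \<delta>\<^sup>i (1 - \<delta>)\<^bsup>N - i\<^esup>\<close>.

  For the scenario bound, first assume that almost surely the optimum of any sample is determined
  by a unique minimal subsample, of size at most \<open>d\<close>. If \<open>\<nu>\<^sub>k\<close> denotes the law of the violation
  probability of \<open>k\<close> samples, restricted to the event that they form a minimal subsample, then
  \<open>\<Sum>k\<le>d. (m choose k) \<integral> (1 - v)\<^bsup>m - k\<^esup> d\<nu>\<^sub>k = 1\<close> for every \<open>m\<close>. The bound is the linear programming
  dual of these identities: the optimal multipliers are the coefficients of the function that
  equals \<open>t\<^sup>N\<close> up to \<open>1 - \<delta>\<close> and its Taylor polynomial of degree \<open>d - 1\<close> beyond, approximated by a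
  polynomial.

  In general the constraints are relaxed by independent uniform amounts of size at most \<open>\<eta>\<close>, and a
  strictly convex term \<open>\<eta> |x|\<^sup>2\<close> is added to the objective. The value of a relaxed problem is convex in each
  relaxation, hence takes a given value above its infimum only once, which makes minimal
  subsamples almost surely unique. Violations persist as \<open>\<eta>\<close> tends to 0.\<close>

section \<open>A linear programming bound for binomial tails\<close>

text \<open>The probability that a binomial variable with parameters \<open>N\<close> and \<delta>
  stays below \<open>d\<close>; it is the sum that \<open>N_exact\<close> compares with
  \<beta>.\<close>

definition binomial_tail :: "nat \<Rightarrow> nat \<Rightarrow> real \<Rightarrow> real" where
  "binomial_tail N d \<delta> = (\<Sum>i<d. real (N choose i) * \<delta> ^ i * (1 - \<delta>) ^ (N - i))"

text \<open>The hypothesis makes \<open>p k\<close> the derivative of order \<open>k\<close> of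
  \<open>p 0\<close> divided by \<open>k!\<close>. The sum is then the Taylor polynomial of
  \<open>p 0\<close> at \<open>t\<close>, evaluated at 1; when the base point \<open>t\<close>
  moves, all terms cancel in pairs except the one from the top order.\<close>

lemma taylor_sum_derivative:
  fixes p :: "nat \<Rightarrow> real \<Rightarrow> real"
  assumes "\<And>k t. (p k has_real_derivative real (Suc k) * p (Suc k) t) (at t)"
  shows "((\<lambda>t. \<Sum>i<d. p i t * (1 - t) ^ i) has_real_derivative
           real d * p d t * (1 - t) ^ (d - 1)) (at t)"
proof -
  let ?a = "\<lambda>i. real i * p i t * (1 - t) ^ (i - 1)"
  have "((\<lambda>t. p i t * (1 - t) ^ i) has_real_derivative ?a (Suc i) - ?a i) (at t)" for i
  proof -
    have "((\<lambda>t::real. (1 - t) ^ i) has_real_derivative - real i * (1 - t) ^ (i - 1)) (at t)"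
      by (auto intro!: derivative_eq_intros)
    from DERIV_mult[OF assms this, of i] show ?thesis
      by (simp add: algebra_simps)
  qed
  then have "((\<lambda>t. \<Sum>i<d. p i t * (1 - t) ^ i) has_real_derivative (\<Sum>i<d. ?a (Suc i) - ?a i)) (at t)"
    by (intro DERIV_sum) auto
  moreover have "(\<Sum>i<d. ?a (Suc i) - ?a i) = ?a d - ?a 0"
    by (rule sum_lessThan_telescope[where f = ?a])
  ultimately have "((\<lambda>t. \<Sum>i<d. p i t * (1 - t) ^ i) has_real_derivative ?a d - ?a 0) (at t)"
    by (simp only:)
  then show ?thesis
    by simp
qed

text \<open>This provides the hypothesis of \<open>taylor_sum_derivative\<close> for the power
  \<open>t ^ N\<close> and, by linearity, for every polynomial. For \<open>k \<ge> N\<close> both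
  sides vanish.\<close>

lemma binomial_power_derivative:
  "((\<lambda>t. real (N choose k) * t ^ (N - k)) has_real_derivative
     real (Suc k) * (real (N choose Suc k) * t ^ (N - Suc k))) (at t)"
proof -
  have "Suc k * (N choose Suc k) = (N choose k) * (N - k)"
    using binomial_absorb_comp[of N k] Suc_times_binomial_eq[of "N - 1" k]
    by (cases N) (auto simp: mult.commute)
  then have *: "real (Suc k) * real (N choose Suc k) = real (N choose k) * real (N - k)"
    by (metis of_nat_mult)
  have "((\<lambda>t. real (N choose k) * t ^ (N - k)) has_real_derivative
     real (N choose k) * real (N - k) * t ^ (N - Suc k)) (at t)"
    by (auto intro!: derivative_eq_intros)
  then show ?thesis
    unfolding *[symmetric] by (simp only: mult.assoc)
qed

lemma derivative_le_imp_le: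
  fixes F G :: "real \<Rightarrow> real"
  assumes "a \<le> b"
    and "\<And>t. (F has_real_derivative F' t) (at t)" "\<And>t. (G has_real_derivative G' t) (at t)"
    and "\<And>t. a \<le> t \<Longrightarrow> t \<le> b \<Longrightarrow> F' t \<le> G' t"
  shows "F b - F a \<le> G b - G a"
proof -
  have "((\<lambda>t. G t - F t) has_real_derivative G' t - F' t) (at t)" for t
    by (intro DERIV_diff assms)
  then have mon: "\<exists>y. ((\<lambda>t. G t - F t) has_real_derivative y) (at t) \<and> 0 \<le> y" if "a \<le> t" "t \<le> b" for t
    using assms(4)[OF that] by (intro exI[of _ "G' t - F' t"] conjI) auto
  have "G a - F a \<le> G b - F b"
    using DERIV_nonneg_imp_nondecreasing[of a b "\<lambda>t. G t - F t", OF assms(1) mon] by simp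
  then show ?thesis by simp
qed

text \<open>The \<mu> are near-optimal dual multipliers. The \<open>d\<close>-th derivative of
  \<open>\<Sum>m\<le>n. \<mu> m * t ^ m\<close> is prescribed as a polynomial slightly above a
  cut-off of that of \<open>t ^ N\<close>; integrating from 0 then gives the lower bounds for all
  \<open>k \<le> d\<close>. The sum of the \<mu> is the value at 1, which the Taylor remainder
  expresses through the \<open>d\<close>-th derivative alone.\<close>

lemma dominating_polynomial:
  assumes "d \<le> N" "1 \<le> d" "0 \<le> \<tau>" "\<tau> < \<tau>'" "\<tau>' \<le> 1" "0 < e"
  obtains \<mu> :: "nat \<Rightarrow> real" and n where
    "\<And>k t. k \<le> d \<Longrightarrow> 0 \<le> t \<Longrightarrow> t \<le> 1 \<Longrightarrow>
       (if t \<le> \<tau> then real (N choose k) * t ^ (N - k) else 0) \<le> (\<Sum>m\<le>n. \<mu> m * (real (m choose k) * t ^ (m - k)))"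
    "(\<Sum>m\<le>n. \<mu> m) \<le> binomial_tail N d (1 - \<tau>') + e"
proof -
  \<comment> \<open>The cut-off equals \<open>(N choose d) * t ^ (N - d)\<close> up to \<tau>, is 0
    from \<tau>' on, and is continuous because the factor is linear in between.\<close>
  define h where "h t = real (N choose d) * t ^ (N - d) * max 0 (min 1 ((\<tau>' - t) / (\<tau>' - \<tau>)))" for t :: real
  \<comment> \<open>A polynomial within \<open>e'\<close> of \<open>h + e'\<close> lies between
    \<open>h\<close> and \<open>h + e / d\<close>; the factor \<open>d\<close> in the derivative of
    the Taylor sum turns this error into \<open>e\<close>.\<close>
  define e' where "e' = e / (2 * real d)"
  have e': "e' > 0" using assms by (simp add: e'_def)
  have "continuous_on {0..1} (\<lambda>t. h t + e')"
    unfolding h_def using assms by (intro continuous_intros) auto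
  from Stone_Weierstrass_real_polynomial_function[OF compact_Icc this e']
  obtain g where g: "real_polynomial_function g" "\<And>t. t \<in> {0..1} \<Longrightarrow> \<bar>h t + e' - g t\<bar> < e'" by blast
  from g(1) obtain a r where ar: "g = (\<lambda>t. \<Sum>i\<le>r. a i * t ^ i)"
    unfolding real_polynomial_function_iff_sum by blast
  \<comment> \<open>These coefficients give \<open>p d = g\<close>. There are no terms of degree
    below \<open>d\<close>, so \<open>p k\<close> vanishes at 0 for all
    \<open>k < d\<close>.\<close>
  define \<mu> where "\<mu> m = (if m < d then 0 else a (m - d) / real (m choose d))" for m
  define n where "n = d + r"
  define p where "p k t = (\<Sum>m\<le>n. \<mu> m * (real (m choose k) * t ^ (m - k)))" for k and t :: real
  define q where "q k t = real (N choose k) * t ^ (N - k)" for k and t :: real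
  have dp: "(p k has_real_derivative real (Suc k) * p (Suc k) t) (at t)" for k t
  proof -
    have "(p k has_real_derivative (\<Sum>m\<le>n. \<mu> m * (real (Suc k) * (real (m choose Suc k) * t ^ (m - Suc k))))) (at t)"
      unfolding p_def[abs_def] by (intro DERIV_sum DERIV_cmult binomial_power_derivative)
    then show ?thesis
      unfolding p_def by (simp add: sum_distrib_left algebra_simps)
  qed
  have dq: "(q k has_real_derivative real (Suc k) * q (Suc k) t) (at t)" for k t
    unfolding q_def[abs_def] by (rule binomial_power_derivative)
  have pd: "p d t = g t" for t
  proof -
    have "p d t = (\<Sum>m\<in>{d..n}. \<mu> m * (real (m choose d) * t ^ (m - d)))"
      unfolding p_def by (rule sum.mono_neutral_right) (auto simp: \<mu>_def n_def)
    also have "\<dots> = (\<Sum>i\<le>r. a i * t ^ i)"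
      by (rule sum.reindex_bij_witness[where i="\<lambda>i. i + d" and j="\<lambda>m. m - d"])
         (auto simp: \<mu>_def n_def)
    finally show ?thesis by (simp add: ar)
  qed
  have h_nonneg: "0 \<le> h t" if "0 \<le> t" for t using that by (simp add: h_def)
  have h_le: "h t \<le> q d t" if "0 \<le> t" for t
    unfolding h_def q_def using that by (intro mult_left_le) auto
  have h_eq: "h t = q d t" if "t \<le> \<tau>" for t
  proof -
    have "1 \<le> (\<tau>' - t) / (\<tau>' - \<tau>)" using that assms by (simp add: le_divide_eq)
    then show ?thesis by (simp add: h_def q_def)
  qed
  have h_0: "h t = 0" if "\<tau>' \<le> t" for t
  proof -
    have "(\<tau>' - t) / (\<tau>' - \<tau>) \<le> 0" using that assms by (intro divide_nonpos_pos) auto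
    then show ?thesis by (simp add: h_def)
  qed
  have pd_ge: "h t \<le> p d t" and pd_le: "p d t \<le> h t + e / real d" if "0 \<le> t" "t \<le> 1" for t
    using g(2)[of t] that assms e' by (auto simp: pd e'_def abs_less_iff field_simps)
  have p0: "p k 0 = 0" if "k < d" for k
    unfolding p_def using that by (intro sum.neutral ballI) (auto simp: \<mu>_def power_0_left)
  have q0: "q k 0 = 0" if "k < d" for k
    using that assms by (simp add: q_def)
  \<comment> \<open>Downward induction on \<open>k\<close>: \<open>p k\<close> starts at 0 and its
    derivative is a positive multiple of \<open>p (Suc k)\<close>. The comparison with
    \<open>q\<close> follows the same pattern.\<close>
  have p_nonneg: "0 \<le> p k t" if "k \<le> d" "0 \<le> t" "t \<le> 1" for k t
    using that
  proof (induction "d - k" arbitrary: k t)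
    case 0
    then show ?case using pd_ge[of t] h_nonneg[of t] by simp
  next
    case (Suc j)
    have "(\<lambda>_. 0::real) t - (\<lambda>_. 0) 0 \<le> p k t - p k 0"
      using Suc by (intro derivative_le_imp_le[OF _ _ dp, where F'="\<lambda>_. 0"]) auto
    then show ?case using p0 Suc by simp
  qed
  have p_ge: "q k t \<le> p k t" if "k \<le> d" "0 \<le> t" "t \<le> \<tau>" for k t
    using that
  proof (induction "d - k" arbitrary: k t)
    case 0
    then show ?case using pd_ge[of t] h_eq[of t] assms by simp
  next
    case (Suc j)
    have "q k t - q k 0 \<le> p k t - p k 0"
      using Suc by (intro derivative_le_imp_le[OF _ dq dp]) (auto intro!: mult_left_mono simp del: of_nat_Suc)
    then show ?case using p0[of k] q0[of k] Suc by simp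
  qed
  \<comment> \<open>\<open>P t\<close> and \<open>R t\<close> are the Taylor polynomials at
    \<open>t\<close>, evaluated at 1, of \<open>p 0\<close> and of \<open>t ^ N\<close>. As the base
    point runs from 0 to 1, \<open>P\<close> grows from 0 to \<open>p 0 1\<close>, which is the sum
    of the \<mu>.\<close>
  define P where "P t = (\<Sum>i<d. p i t * (1 - t) ^ i)" for t
  define R where "R t = (\<Sum>i<d. q i t * (1 - t) ^ i)" for t
  have dP: "(P has_real_derivative real d * p d t * (1 - t) ^ (d - 1)) (at t)" for t
    unfolding P_def[abs_def] by (rule taylor_sum_derivative) (rule dp)
  have dR: "(R has_real_derivative real d * q d t * (1 - t) ^ (d - 1)) (at t)" for t
    unfolding R_def[abs_def] by (rule taylor_sum_derivative) (rule dq)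
  have bnd: "real d * p d t * (1 - t) ^ (d - 1) \<le> real d * h t * (1 - t) ^ (d - 1) + e"
    if "0 \<le> t" "t \<le> 1" for t
  proof -
    have "real d * p d t * (1 - t) ^ (d - 1) \<le> real d * (h t + e / real d) * (1 - t) ^ (d - 1)"
      using that pd_le[of t] by (intro mult_right_mono mult_left_mono) auto
    also have "\<dots> = real d * h t * (1 - t) ^ (d - 1) + e * (1 - t) ^ (d - 1)"
      using assms by (simp add: field_simps)
    also have "e * (1 - t) ^ (d - 1) \<le> e * 1"
      using that assms by (intro mult_left_mono power_le_one) auto
    finally show ?thesis by simp
  qed
  have "P \<tau>' - P 0 \<le> (R \<tau>' + e * \<tau>') - (R 0 + e * 0)"
  proof (rule derivative_le_imp_le[OF _ dP])
    fix t assume t: "0 \<le> t" "t \<le> \<tau>'"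
    have "real d * h t * (1 - t) ^ (d - 1) \<le> real d * q d t * (1 - t) ^ (d - 1)"
      using t assms h_le[of t] by (intro mult_right_mono mult_left_mono) auto
    with bnd[of t] t assms show "real d * p d t * (1 - t) ^ (d - 1) \<le> real d * q d t * (1 - t) ^ (d - 1) + e"
      by linarith
  next
    show "((\<lambda>t. R t + e * t) has_real_derivative real d * q d t * (1 - t) ^ (d - 1) + e) (at t)" for t
      by (intro DERIV_add dR) (auto intro!: derivative_eq_intros)
  qed (use assms in auto)
  \<comment> \<open>Beyond \<tau>' the cut-off is 0 and only the approximation error
    contributes.\<close>
  moreover have "P 1 - P \<tau>' \<le> e * 1 - e * \<tau>'"
  proof (rule derivative_le_imp_le[OF _ dP])
    fix t assume t: "\<tau>' \<le> t" "t \<le> 1"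
    then show "real d * p d t * (1 - t) ^ (d - 1) \<le> e"
      using bnd[of t] h_0[of t] assms by auto
  next
    show "((\<lambda>t. e * t) has_real_derivative e) (at t)" for t
      by (auto intro!: derivative_eq_intros)
  qed (use assms in auto)
  moreover have "P 0 = 0" "R 0 = 0"
    unfolding P_def R_def using p0 q0 by auto
  moreover have "P 1 = (\<Sum>m\<le>n. \<mu> m)"
  proof -
    have "P 1 = (\<Sum>i\<in>{0}. p i 1 * (1 - 1) ^ i)"
      unfolding P_def using assms by (intro sum.mono_neutral_right) auto
    then show ?thesis by (simp add: p_def)
  qed
  moreover have "R \<tau>' = binomial_tail N d (1 - \<tau>')"
    unfolding R_def q_def binomial_tail_def by (intro sum.cong) (auto simp: algebra_simps)
  ultimately have "(\<Sum>m\<le>n. \<mu> m) \<le> binomial_tail N d (1 - \<tau>') + e"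
    by simp
  moreover have "(if t \<le> \<tau> then real (N choose k) * t ^ (N - k) else 0) \<le> p k t"
    if "k \<le> d" "0 \<le> t" "t \<le> 1" for k t
    using p_nonneg[OF that] p_ge[of k t] that by (auto simp: q_def)
  ultimately show ?thesis
    unfolding p_def by (intro that) auto
qed

text \<open>Weak duality of linear programming: \<open>moments\<close> are the equality constraints
  on the unknown measures \<nu>. Integrating the dominating inequality and exchanging the sums
  leaves only the sum of the multipliers.\<close>

lemma binomial_tail_duality:
  fixes \<nu> :: "nat \<Rightarrow> real measure"
  assumes fin: "\<And>k. finite_measure (\<nu> k)" and sets: "\<And>k. sets (\<nu> k) = sets borel"
    and supp: "\<And>k. AE v in \<nu> k. 0 \<le> v \<and> v \<le> 1"
    and moments: "\<And>m. (\<Sum>k\<le>d. real (m choose k) * (\<integral>v. (1 - v) ^ (m - k) \<partial>\<nu> k)) = 1"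
    and d: "d \<le> N" "1 \<le> d" and \<delta>: "0 \<le> \<delta>'" "\<delta>' < \<delta>" "\<delta> \<le> 1"
  shows "(\<Sum>k\<le>d. real (N choose k) * (\<integral>v. indicator {\<delta>..} v * (1 - v) ^ (N - k) \<partial>\<nu> k)) \<le> binomial_tail N d \<delta>'"
proof (rule field_le_epsilon)
  fix e :: real assume e: "0 < e"
  \<comment> \<open>The polynomial is used at \<open>t = 1 - v\<close>, so that
    \<open>v \<ge> \<delta>\<close> reads \<open>t \<le> 1 - \<delta>\<close>. The gap between
    \<delta>' and \<delta> is the room for the linear cut-off.\<close>
  obtain \<mu> n where \<mu>: "\<And>k t. k \<le> d \<Longrightarrow> 0 \<le> t \<Longrightarrow> t \<le> 1 \<Longrightarrow>
       (if t \<le> 1 - \<delta> then real (N choose k) * t ^ (N - k) else 0) \<le> (\<Sum>m\<le>n. \<mu> m * (real (m choose k) * t ^ (m - k)))"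
    and s: "(\<Sum>m\<le>n. \<mu> m) \<le> binomial_tail N d \<delta>' + e"
    using dominating_polynomial[OF d, of "1 - \<delta>" "1 - \<delta>'" e] \<delta> e by (auto simp: algebra_simps)
  have [measurable_cong]: "sets (\<nu> k) = sets borel" for k by (rule sets)
  have int_pow: "integrable (\<nu> k) (\<lambda>v. (1 - v) ^ j)" for k j
  proof -
    interpret finite_measure "\<nu> k" by (rule fin)
    show ?thesis
      by (rule integrable_const_bound[where B=1])
         (use supp[of k] in \<open>eventually_elim, auto simp: power_abs intro!: power_le_one\<close>, measurable)
  qed
  have int_ind: "integrable (\<nu> k) (\<lambda>v. indicator {\<delta>..} v * (1 - v) ^ j)" for k j
    using integrable_real_mult_indicator[OF _ int_pow[of k j], of "{\<delta>..}"] by (simp add: sets mult.commute)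
  have "(\<Sum>k\<le>d. real (N choose k) * (\<integral>v. indicator {\<delta>..} v * (1 - v) ^ (N - k) \<partial>\<nu> k))
     = (\<Sum>k\<le>d. \<integral>v. real (N choose k) * (indicator {\<delta>..} v * (1 - v) ^ (N - k)) \<partial>\<nu> k)"
    by simp
  also have "\<dots> \<le> (\<Sum>k\<le>d. \<integral>v. (\<Sum>m\<le>n. \<mu> m * (real (m choose k) * (1 - v) ^ (m - k))) \<partial>\<nu> k)"
  proof (intro sum_mono integral_mono_AE)
    fix k assume k: "k \<in> {..d}"
    show "AE v in \<nu> k. real (N choose k) * (indicator {\<delta>..} v * (1 - v) ^ (N - k))
        \<le> (\<Sum>m\<le>n. \<mu> m * (real (m choose k) * (1 - v) ^ (m - k)))"
      using supp[of k]
    proof eventually_elim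
      case (elim v)
      then show ?case using \<mu>[of k "1 - v"] k by (auto simp: indicator_def split: if_splits)
    qed
  qed (auto intro!: int_ind int_pow Bochner_Integration.integrable_sum integrable_mult_right)
  also have "\<dots> = (\<Sum>k\<le>d. \<Sum>m\<le>n. \<mu> m * (real (m choose k) * (\<integral>v. (1 - v) ^ (m - k) \<partial>\<nu> k)))"
    by (simp add: int_pow)
  also have "\<dots> = (\<Sum>m\<le>n. \<mu> m * (\<Sum>k\<le>d. real (m choose k) * (\<integral>v. (1 - v) ^ (m - k) \<partial>\<nu> k)))"
    by (subst sum.swap) (simp add: sum_distrib_left)
  also have "\<dots> = (\<Sum>m\<le>n. \<mu> m)" by (simp add: moments)
  also note s
  finally show "(\<Sum>k\<le>d. real (N choose k) * (\<integral>v. indicator {\<delta>..} v * (1 - v) ^ (N - k) \<partial>\<nu> k)) \<le> binomial_tail N d \<delta>' + e" .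
qed

section \<open>Random problems of LP type\<close>

text \<open>Here \<open>f\<close> stands for the optimal value as a function of the set of
  constraints. \<open>locality\<close> is the combinatorial trace of a unique optimizer,
  \<open>small_basis\<close> bounds the number of decisive constraints, and \<open>generic\<close>
  forbids that a random constraint raises the value exactly to that of a fixed other set; the
  uniqueness of bases comes from it.\<close>

locale random_lp = prob_space M for M :: "'z measure" +
  fixes f :: "'z set \<Rightarrow> real" and d :: nat
  assumes mono: "finite B \<Longrightarrow> A \<subseteq> B \<Longrightarrow> f A \<le> f B"
    and locality: "finite A \<Longrightarrow> finite T \<Longrightarrow> (\<And>w. w \<in> T \<Longrightarrow> f (insert w A) = f A) \<Longrightarrow> f (A \<union> T) = f A"
    and small_basis: "finite A \<Longrightarrow> \<exists>B\<subseteq>A. card B \<le> d \<and> f B = f A"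
    and measurable_value: "finite J \<Longrightarrow> (\<lambda>z. f (z ` J)) \<in> borel_measurable (Pi\<^sub>M J (\<lambda>_::nat. M))"
    and generic: "finite A \<Longrightarrow> finite B \<Longrightarrow>
      AE w in M. \<not> (f A < f (insert w A) \<and> f (insert w A) = f B)"
begin

definition violation :: "'z set \<Rightarrow> real" where
  "violation A = prob {w \<in> space M. f A < f (insert w A)}"

definition minimal :: "nat set \<Rightarrow> (nat \<Rightarrow> 'z) \<Rightarrow> bool" where
  "minimal J z \<longleftrightarrow> (\<forall>j\<in>J. f (z ` (J - {j})) < f (z ` J))"

text \<open>Subsamples are recorded by their indices: for a fixed \<open>J\<close> this is an event
  of the product space, and the candidates are counted by binomial coefficients.\<close>

definition basis :: "nat set \<Rightarrow> nat set \<Rightarrow> (nat \<Rightarrow> 'z) \<Rightarrow> bool" where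
  "basis I J z \<longleftrightarrow> J \<subseteq> I \<and> minimal J z \<and> f (z ` J) = f (z ` I)"

abbreviation Pow_measure :: "nat set \<Rightarrow> (nat \<Rightarrow> 'z) measure" where
  "Pow_measure I \<equiv> Pi\<^sub>M I (\<lambda>_. M)"

sublocale P: product_prob_space "\<lambda>_::nat. M" UNIV
  by unfold_locales

section \<open>Measurability of values, violation probabilities and basis events\<close>

lemma prob_space_Pow_measure: "prob_space (Pow_measure I)"
  by (intro prob_space_PiM) unfold_locales

lemma measurable_value_subset:
  assumes "J \<subseteq> K" "finite K"
  shows "(\<lambda>z. f (z ` J)) \<in> borel_measurable (Pow_measure K)"
proof -
  have "(\<lambda>z. f (restrict z J ` J)) \<in> borel_measurable (Pow_measure K)"
    by (rule measurable_compose[OF measurable_restrict_subset measurable_value])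
       (use assms in \<open>auto intro: finite_subset\<close>)
  then show ?thesis by simp
qed

lemma measurable_value_insert:
  assumes "finite J"
  shows "(\<lambda>(z, w). f (insert w (z ` J))) \<in> borel_measurable (Pow_measure J \<Otimes>\<^sub>M M)"
proof -
  \<comment> \<open>A fresh index turns the additional constraint \<open>w\<close> into one more
    coordinate.\<close>
  obtain i where i: "i \<notin> J" using assms by (metis ex_new_if_finite infinite_UNIV_nat)
  have "(\<lambda>x. f ((case x of (z, w) \<Rightarrow> z(i := w)) ` insert i J)) \<in> borel_measurable (Pow_measure J \<Otimes>\<^sub>M M)"
    by (rule measurable_compose[OF measurable_add_dim measurable_value_subset]) (use assms in auto)
  moreover have "(z(i := w)) ` insert i J = insert w (z ` J)" for z :: "nat \<Rightarrow> 'z" and w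
    using i by auto
  ultimately show ?thesis by (simp add: case_prod_beta')
qed

lemma sets_violation:
  assumes "finite J" "z \<in> space (Pow_measure J)"
  shows "{w \<in> space M. f (z ` J) < f (insert w (z ` J))} \<in> sets M"
proof -
  have "(\<lambda>w. f (insert w (z ` J))) \<in> borel_measurable M"
    using measurable_compose[OF measurable_Pair1'[OF assms(2)] measurable_value_insert[OF assms(1)]] by simp
  then show ?thesis by measurable
qed

lemma measurable_violation:
  assumes "finite J"
  shows "(\<lambda>z. violation (z ` J)) \<in> borel_measurable (Pow_measure J)"
proof -
  have [measurable]: "(\<lambda>x. f (insert (snd x) (fst x ` J))) \<in> borel_measurable (Pow_measure J \<Otimes>\<^sub>M M)"
    using measurable_value_insert[OF assms] by (simp add: case_prod_beta')
  have [measurable]: "(\<lambda>x. f (fst x ` J)) \<in> borel_measurable (Pow_measure J \<Otimes>\<^sub>M M)"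
    using measurable_compose[OF measurable_fst measurable_value[OF assms]] .
  have "{x \<in> space (Pow_measure J \<Otimes>\<^sub>M M). snd x \<in> {w \<in> space M. f (fst x ` J) < f (insert w (fst x ` J))}}
      = {x \<in> space (Pow_measure J \<Otimes>\<^sub>M M). f (fst x ` J) < f (insert (snd x) (fst x ` J))}"
    by (auto simp: space_pair_measure)
  also have "\<dots> \<in> sets (Pow_measure J \<Otimes>\<^sub>M M)" by measurable
  finally have "(\<lambda>z. emeasure M {w \<in> space M. f (z ` J) < f (insert w (z ` J))}) \<in> borel_measurable (Pow_measure J)"
    by (intro measurable_emeasure) auto
  then show ?thesis
    unfolding violation_def measure_def by measurable
qed

lemma measurable_violation_subset:
  assumes "J \<subseteq> K" "finite K"
  shows "(\<lambda>z. violation (z ` J)) \<in> borel_measurable (Pow_measure K)"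
proof -
  have "(\<lambda>z. violation (restrict z J ` J)) \<in> borel_measurable (Pow_measure K)"
    by (rule measurable_compose[OF measurable_restrict_subset measurable_violation])
       (use assms in \<open>auto intro: finite_subset\<close>)
  then show ?thesis by simp
qed

lemma violation_bounds: "0 \<le> violation A" "violation A \<le> 1"
  unfolding violation_def by auto

lemma sets_minimal:
  assumes "J \<subseteq> K" "finite K"
  shows "Measurable.pred (Pow_measure K) (minimal J)"
proof -
  have "(\<lambda>z. f (z ` (J - {j}))) \<in> borel_measurable (Pow_measure K)"
    "(\<lambda>z. f (z ` J)) \<in> borel_measurable (Pow_measure K)" for j
    by (intro measurable_value_subset; use assms in auto)+
  then have "Measurable.pred (Pow_measure K) (\<lambda>z. f (z ` (J - {j})) < f (z ` J))" for j
    by measurable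
  then show ?thesis
    unfolding minimal_def[abs_def] using finite_subset[OF assms]
    by (intro pred_intros_finite) auto
qed

lemma measurable_value_eq:
  assumes "J \<subseteq> I" "K \<subseteq> I" "finite I"
  shows "Measurable.pred (Pow_measure I) (\<lambda>z. f (z ` J) = f (z ` K))"
  using borel_measurable_eq[OF measurable_value_subset measurable_value_subset] assms
  by (simp add: pred_def)

lemma sets_basis:
  assumes "finite I"
  shows "Measurable.pred (Pow_measure I) (basis I J)"
proof (cases "J \<subseteq> I")
  case True
  have [measurable]: "Measurable.pred (Pow_measure I) (\<lambda>z. f (z ` J) = f (z ` I))"
    "Measurable.pred (Pow_measure I) (minimal J)"
    using True assms by (auto intro!: measurable_value_eq sets_minimal)
  then show ?thesis
    unfolding basis_def[abs_def] using True by simp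
next
  case False
  then show ?thesis unfolding basis_def[abs_def] by simp
qed

section \<open>Existence and almost sure uniqueness of bases\<close>

lemma value_mono: "finite K \<Longrightarrow> J \<subseteq> K \<Longrightarrow> f (z ` J) \<le> f (z ` K)"
  by (intro mono image_mono) auto

text \<open>Among the index sets with the full value, one of least cardinality is minimal: deleting
  an index must change the value, and by monotonicity it can only lower it.\<close>

lemma basis_exists:
  assumes "finite I"
  obtains J where "basis I J z" "card J \<le> d"
proof -
  obtain B where B: "B \<subseteq> z ` I" "card B \<le> d" "f B = f (z ` I)"
    using small_basis[of "z ` I"] assms by auto
  \<comment> \<open>One index for each constraint in \<open>B\<close>, so that the bound on
    \<open>card B\<close> carries over to indices even if constraints repeat.\<close>
  obtain J0 where J0: "J0 \<subseteq> I" "inj_on z J0" "B = z ` J0"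
    using B(1) unfolding subset_image_inj by blast
  define Q where "Q J \<longleftrightarrow> J \<subseteq> I \<and> f (z ` J) = f (z ` I)" for J
  obtain J where J: "Q J" "\<And>K. Q K \<Longrightarrow> card J \<le> card K"
    using ex_has_least_nat[of Q J0 card] B J0 unfolding Q_def by metis
  have "card J0 \<le> d" using B J0 by (simp add: card_image)
  then have "card J \<le> d"
    using J(2)[of J0] B J0 unfolding Q_def by auto
  moreover have "minimal J z"
    unfolding minimal_def
  proof
    fix j assume j: "j \<in> J"
    have fin: "finite J" using J(1) assms finite_subset unfolding Q_def by blast
    then have "\<not> Q (J - {j})"
      using J(2)[of "J - {j}"] j by (metis card_Diff1_less not_less)
    then have "f (z ` (J - {j})) \<noteq> f (z ` J)"
      using J(1) unfolding Q_def by auto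
    then show "f (z ` (J - {j})) < f (z ` J)"
      using value_mono[OF fin, of "J - {j}" z] by auto
  qed
  ultimately show ?thesis
    using that J(1) unfolding basis_def Q_def by auto
qed

text \<open>Fubini: with all coordinates but \<open>i\<close> frozen, the values on
  \<open>J - {i}\<close> and on \<open>K\<close> are constants, and \<open>generic\<close> excludes
  almost every choice of coordinate \<open>i\<close>.\<close>

lemma AE_not_degenerate:
  assumes "finite I" "J \<subseteq> I" "K \<subseteq> I" "i \<in> J" "i \<notin> K"
  shows "AE z in Pow_measure I. \<not> (f (z ` (J - {i})) < f (z ` J) \<and> f (z ` J) = f (z ` K))"
proof -
  let ?P = "\<lambda>z. f (z ` (J - {i})) < f (z ` J) \<and> f (z ` J) = f (z ` K)"
  define I' where "I' = I - {i}"
  have I: "I = insert i I'" "i \<notin> I'" "finite I'" using assms by (auto simp: I'_def)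
  have [measurable]: "(\<lambda>z. f (z ` J)) \<in> borel_measurable (Pow_measure I)"
    "(\<lambda>z. f (z ` (J - {i}))) \<in> borel_measurable (Pow_measure I)"
    "Measurable.pred (Pow_measure I) (\<lambda>z. f (z ` J) = f (z ` K))"
    using assms by (auto intro!: measurable_value_subset measurable_value_eq)
  have Pm [measurable]: "Measurable.pred (Pow_measure I) ?P" by measurable
  have "(\<integral>\<^sup>+z. indicator {z \<in> space (Pow_measure I). ?P z} z \<partial>Pow_measure I)
     = (\<integral>\<^sup>+x. \<integral>\<^sup>+w. indicator {z \<in> space (Pow_measure I). ?P z} (x(i := w)) \<partial>M \<partial>Pow_measure I')"
    using P.product_nn_integral_insert[of I' i "indicator {z \<in> space (Pow_measure I). ?P z}"] I Pm
    by (simp add: pred_def)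
  also have "\<dots> = (\<integral>\<^sup>+x. 0 \<partial>Pow_measure I')"
  proof (intro nn_integral_cong)
    fix x :: "nat \<Rightarrow> 'z"
    have eq: "(x(i := w)) ` (J - {i}) = x ` (J - {i})" "(x(i := w)) ` K = x ` K"
      "(x(i := w)) ` J = insert w (x ` (J - {i}))" for w
      using assms by auto
    have "AE w in M. \<not> ?P (x(i := w))"
      using generic[of "x ` (J - {i})" "x ` K"] assms finite_subset[of _ I]
      unfolding eq by auto
    then have "AE w in M. (indicator {z \<in> space (Pow_measure I). ?P z} (x(i := w)) :: ennreal) = 0"
      by eventually_elim auto
    then have "(\<integral>\<^sup>+w. indicator {z \<in> space (Pow_measure I). ?P z} (x(i := w)) \<partial>M) = (\<integral>\<^sup>+w. 0 \<partial>M)"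
      by (rule nn_integral_cong_AE)
    then show "(\<integral>\<^sup>+w. indicator {z \<in> space (Pow_measure I). ?P z} (x(i := w)) \<partial>M) = 0" by simp
  qed
  finally have "emeasure (Pow_measure I) {z \<in> space (Pow_measure I). ?P z} = 0"
    using Pm by (simp add: pred_def)
  then show ?thesis
    using Pm by (subst AE_iff_measurable[OF _ refl]) (auto simp: pred_def)
qed

text \<open>An index in one basis but not in another is essential for the first, while both bases
  have the value of \<open>I\<close>. There are finitely many such coincidences, each of them
  null.\<close>

lemma AE_basis_unique:
  assumes "finite I"
  shows "AE z in Pow_measure I. \<forall>J K. basis I J z \<longrightarrow> basis I K z \<longrightarrow> J = K"
proof -
  have "AE z in Pow_measure I. \<forall>J\<in>Pow I. \<forall>K\<in>Pow I. \<forall>i\<in>J - K.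
      \<not> (f (z ` (J - {i})) < f (z ` J) \<and> f (z ` J) = f (z ` K))"
    using assms by (intro AE_finite_allI finite_Pow_iff[THEN iffD2] AE_not_degenerate)
      (auto intro: finite_subset)
  then show ?thesis
  proof eventually_elim
    case (elim z)
    have "J \<subseteq> K" if "basis I J z" "basis I K z" for J K
    proof
      fix i assume "i \<in> J"
      show "i \<in> K"
      proof (rule ccontr)
        assume "i \<notin> K"
        then have "\<not> (f (z ` (J - {i})) < f (z ` J) \<and> f (z ` J) = f (z ` K))"
          using elim that \<open>i \<in> J\<close> unfolding basis_def by (meson DiffI PowI)
        then show False using that \<open>i \<in> J\<close> unfolding basis_def minimal_def by auto
      qed
    qed
    then show ?case by blast
  qed
qed

text \<open>Locality splits the condition on the whole sample into one condition for each index
  outside \<open>J\<close>. Given the coordinates in \<open>J\<close>, these conditions are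
  independent.\<close>

lemma basis_iff:
  assumes "finite I" "J \<subseteq> I"
  shows "basis I J z \<longleftrightarrow> minimal J z \<and> (\<forall>i\<in>I - J. f (insert (z i) (z ` J)) = f (z ` J))"
proof -
  have fin: "finite J" using assms finite_subset by blast
  have "f (z ` J) = f (z ` I) \<longleftrightarrow> (\<forall>i\<in>I - J. f (insert (z i) (z ` J)) = f (z ` J))"
  proof safe
    fix i assume eq: "f (z ` J) = f (z ` I)" and i: "i \<in> I" "i \<notin> J"
    have "f (z ` J) \<le> f (insert (z i) (z ` J))" "f (insert (z i) (z ` J)) \<le> f (z ` I)"
      using assms i fin by (auto intro!: mono)
    with eq show "f (insert (z i) (z ` J)) = f (z ` J)" by simp
  next
    assume *: "\<forall>i\<in>I - J. f (insert (z i) (z ` J)) = f (z ` J)"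
    have "f (z ` J \<union> z ` (I - J)) = f (z ` J)"
      using assms fin * by (intro locality) auto
    moreover have "z ` J \<union> z ` (I - J) = z ` I" using assms by auto
    ultimately show "f (z ` J) = f (z ` I)" by simp
  qed
  then show ?thesis unfolding basis_def using assms by blast
qed

lemma emeasure_basis:
  assumes I: "finite I" "J \<subseteq> I" and B [measurable]: "B \<in> sets borel"
  shows "emeasure (Pow_measure I) {z \<in> space (Pow_measure I). basis I J z \<and> violation (z ` J) \<in> B}
    = (\<integral>\<^sup>+x. indicator {x. minimal J x} x * (indicator B (violation (x ` J)) * ennreal ((1 - violation (x ` J)) ^ (card I - card J))) \<partial>Pow_measure J)"
    (is "emeasure _ ?E = _")
proof -
  define T where "T = I - J"
  have fin: "finite J" "finite T" and IJ: "J \<inter> T = {}" "J \<union> T = I"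
    using I finite_subset by (auto simp: T_def)
  have cT: "card T = card I - card J" using I fin by (simp add: T_def card_Diff_subset)
  have [measurable]: "(\<lambda>z. violation (z ` J)) \<in> borel_measurable (Pow_measure I)"
    "Measurable.pred (Pow_measure I) (basis I J)"
    using I by (auto intro!: measurable_violation_subset sets_basis)
  have E [measurable]: "?E \<in> sets (Pow_measure I)"
    by measurable
  have "emeasure (Pow_measure I) ?E = (\<integral>\<^sup>+z. indicator ?E z \<partial>Pow_measure (J \<union> T))"
    by (simp add: IJ)
  also have "\<dots> = (\<integral>\<^sup>+x. \<integral>\<^sup>+y. indicator ?E (merge J T (x, y)) \<partial>Pow_measure T \<partial>Pow_measure J)"
    using E by (intro P.product_nn_integral_fold IJ fin) (simp add: IJ)
  also have "\<dots> = (\<integral>\<^sup>+x. indicator {x. minimal J x} x * (indicator B (violation (x ` J)) * ennreal ((1 - violation (x ` J)) ^ (card I - card J))) \<partial>Pow_measure J)"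
  proof (rule nn_integral_cong)
    fix x assume x: "x \<in> space (Pow_measure J)"
    \<comment> \<open>The harmless draws: by \<open>basis_iff\<close> the coordinates in
      \<open>T\<close> must all fall into this set.\<close>
    define N where "N = {w \<in> space M. \<not> f (x ` J) < f (insert w (x ` J))}"
    have N: "N \<in> sets M" and pN: "prob N = 1 - violation (x ` J)"
      unfolding N_def violation_def using prob_neg[of "\<lambda>w. f (x ` J) < f (insert w (x ` J))"] sets_violation[OF fin(1) x]
      by (auto intro: sets.sets_Collect_neg)
    have sp: "merge J T (x, y) \<in> space (Pow_measure I)" if "y \<in> space (Pow_measure T)" for y
      using x that IJ measurable_space[OF measurable_merge[of J T "\<lambda>_. M"], of "(x, y)"]
      by (simp add: space_pair_measure)
    have im: "merge J T (x, y) ` J = x ` J" for y using IJ by (auto simp: image_iff)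
    have mi: "minimal J (merge J T (x, y)) \<longleftrightarrow> minimal J x" for y
    proof -
      have "merge J T (x, y) ` (J - {j}) = x ` (J - {j})" for j using IJ by (intro image_cong) auto
      then show ?thesis unfolding minimal_def im by simp
    qed
    have iff: "f (insert w (x ` J)) = f (x ` J) \<longleftrightarrow> \<not> f (x ` J) < f (insert w (x ` J))" for w
      using mono[OF _ subset_insertI[of "x ` J" w]] fin by auto
    have "indicator ?E (merge J T (x, y)) = (indicator {x. minimal J x} x * indicator B (violation (x ` J)) * indicator (Pi\<^sub>E T (\<lambda>_. N)) y :: ennreal)"
      if y: "y \<in> space (Pow_measure T)" for y
    proof -
      have "y \<in> Pi\<^sub>E T (\<lambda>_. N) \<longleftrightarrow> (\<forall>i\<in>T. f (insert (y i) (x ` J)) = f (x ` J))"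
        using y unfolding space_PiM N_def iff by (auto simp: PiE_iff)
      moreover have "(\<forall>i\<in>I - J. f (insert (merge J T (x, y) i) (x ` J)) = f (x ` J)) \<longleftrightarrow> (\<forall>i\<in>T. f (insert (y i) (x ` J)) = f (x ` J))"
        using IJ by (auto simp: T_def)
      ultimately show ?thesis
        using sp[OF y] by (auto simp: basis_iff[OF I] im mi indicator_def)
    qed
    then have "(\<integral>\<^sup>+y. indicator ?E (merge J T (x, y)) \<partial>Pow_measure T)
       = (\<integral>\<^sup>+y. indicator {x. minimal J x} x * indicator B (violation (x ` J)) * indicator (Pi\<^sub>E T (\<lambda>_. N)) y \<partial>Pow_measure T)"
      by (rule nn_integral_cong)
    also have "\<dots> = indicator {x. minimal J x} x * indicator B (violation (x ` J)) * emeasure (Pow_measure T) (Pi\<^sub>E T (\<lambda>_. N))"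
      using N fin by (subst nn_integral_cmult_indicator) (auto intro!: sets_PiM_I_finite)
    also have "emeasure (Pow_measure T) (Pi\<^sub>E T (\<lambda>_. N)) = ennreal (prob N) ^ card T"
      using P.emeasure_PiM[of T "\<lambda>_. N"] fin N by (simp add: emeasure_eq_measure)
    also have "\<dots> = ennreal ((1 - violation (x ` J)) ^ (card I - card J))"
      unfolding pN cT using violation_bounds by (simp add: ennreal_power)
    finally show "(\<integral>\<^sup>+y. indicator ?E (merge J T (x, y)) \<partial>Pow_measure T) = indicator {x. minimal J x} x * (indicator B (violation (x ` J)) * ennreal ((1 - violation (x ` J)) ^ (card I - card J)))"
      by (simp add: mult.assoc)
  qed
  finally show ?thesis .
qed

text \<open>The measure \<nu> of index \<open>k\<close> in the overview. It is not normalized: its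
  mass is the probability that \<open>k\<close> draws form a minimal subsample.\<close>

definition basis_law :: "nat \<Rightarrow> real measure" where
  "basis_law k = distr (density (Pow_measure {..<k}) (indicator {x. minimal {..<k} x})) borel (\<lambda>x. violation (x ` {..<k}))"

lemma sets_basis_law [simp, measurable_cong]: "sets (basis_law k) = sets borel"
  by (simp add: basis_law_def)

text \<open>Exchangeability: relabelling the coordinates by a bijection preserves the product
  measure and minimality, so only the cardinality of \<open>J\<close> matters.\<close>

lemma nn_integral_basis_law:
  assumes J: "finite J" and [measurable]: "h \<in> borel_measurable borel"
  shows "(\<integral>\<^sup>+x. indicator {x. minimal J x} x * h (violation (x ` J)) \<partial>Pow_measure J) = (\<integral>\<^sup>+v. h v \<partial>basis_law (card J))"
proof -
  define K where "K = {..<card J}"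
  obtain \<pi> where \<pi>: "bij_betw \<pi> K J"
    using J ex_bij_betw_nat_finite[of J] by (auto simp: K_def atLeast0LessThan)
  let ?t = "\<lambda>\<omega>. \<lambda>n\<in>K. \<omega> (\<pi> n) :: 'z"
  have K: "finite K" by (simp add: K_def)
  have [measurable]: "(\<lambda>z. violation (z ` K)) \<in> borel_measurable (Pow_measure K)"
    "Measurable.pred (Pow_measure K) (minimal K)"
    using K by (auto intro!: measurable_violation_subset sets_minimal)
  have mK: "{x \<in> space (Pow_measure K). minimal K x} \<in> sets (Pow_measure K)"
    by measurable
  have indK: "(indicator {x. minimal K x} :: _ \<Rightarrow> ennreal) \<in> borel_measurable (Pow_measure K)"
    by (rule borel_measurable_indicator') (use mK in simp)
  have [measurable]: "?t \<in> measurable (Pow_measure J) (Pow_measure K)"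
    using \<pi> by (intro measurable_restrict measurable_component_singleton) (auto simp: bij_betw_def)
  have im: "?t \<omega> ` A = \<omega> ` (\<pi> ` A)" if "A \<subseteq> K" for \<omega> A
    using that by (auto simp: image_iff subset_iff)
  have imK: "?t \<omega> ` K = \<omega> ` J" for \<omega> using im[of K] \<pi> by (simp add: bij_betw_def)
  have "minimal K (?t \<omega>) \<longleftrightarrow> minimal J \<omega>" for \<omega>
  proof -
    have "?t \<omega> ` (K - {k}) = \<omega> ` (J - {\<pi> k})" if "k \<in> K" for k
    proof -
      have "\<pi> ` (K - {k}) = J - {\<pi> k}"
        using \<pi> that by (auto simp: bij_betw_def inj_on_def)
      then show ?thesis using im[of "K - {k}"] by auto
    qed
    moreover have "J = \<pi> ` K" using \<pi> by (simp add: bij_betw_def)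
    ultimately show ?thesis unfolding minimal_def imK by auto
  qed
  then have "(\<integral>\<^sup>+x. indicator {x. minimal J x} x * h (violation (x ` J)) \<partial>Pow_measure J)
     = (\<integral>\<^sup>+x. indicator {x. minimal K x} (?t x) * h (violation (?t x ` K)) \<partial>Pow_measure J)"
    unfolding imK by (simp add: indicator_def)
  also have "\<dots> = (\<integral>\<^sup>+x. indicator {x. minimal K x} x * h (violation (x ` K)) \<partial>distr (Pow_measure J) (Pow_measure K) ?t)"
    using indK by (subst nn_integral_distr) auto
  also have "distr (Pow_measure J) (Pow_measure K) ?t = Pow_measure K"
    using \<pi> by (intro distr_PiM_reindex prob_space_axioms) (auto simp: bij_betw_def)
  also have "(\<integral>\<^sup>+x. indicator {x. minimal K x} x * h (violation (x ` K)) \<partial>Pow_measure K) = (\<integral>\<^sup>+v. h v \<partial>basis_law (card J))"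
    unfolding basis_law_def K_def[symmetric] using indK
    by (subst nn_integral_distr) (auto simp: nn_integral_density)
  finally show ?thesis .
qed

section \<open>Moment identities for the basis laws\<close>

lemma emeasure_basis':
  assumes "finite I" "J \<subseteq> I" and [measurable]: "B \<in> sets borel"
  shows "emeasure (Pow_measure I) {z \<in> space (Pow_measure I). basis I J z \<and> violation (z ` J) \<in> B}
    = (\<integral>\<^sup>+v. indicator B v * ennreal ((1 - v) ^ (card I - card J)) \<partial>basis_law (card J))"
  unfolding emeasure_basis[OF assms]
  using assms finite_subset by (intro nn_integral_basis_law) auto

lemma finite_measure_basis_law: "finite_measure (basis_law k)"
proof
  have "emeasure (basis_law k) (space (basis_law k)) = (\<integral>\<^sup>+x. indicator {x. minimal {..<k} x} x * 1 \<partial>Pow_measure {..<k})"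
    using nn_integral_basis_law[of "{..<k}" "\<lambda>_. 1"] by simp
  also have "\<dots> \<le> (\<integral>\<^sup>+x. 1 \<partial>Pow_measure {..<k})"
    by (intro nn_integral_mono) (simp add: indicator_def)
  also have "\<dots> = 1"
    using prob_space.emeasure_space_1[OF prob_space_Pow_measure] by simp
  finally show "emeasure (basis_law k) (space (basis_law k)) \<noteq> \<infinity>" by (auto simp: top_unique)
qed

lemma AE_basis_law: "AE v in basis_law k. 0 \<le> v \<and> v \<le> 1"
proof -
  have [measurable]: "(\<lambda>z. violation (z ` {..<k})) \<in> borel_measurable (Pow_measure {..<k})"
    by (auto intro!: measurable_violation_subset)
  show ?thesis
    unfolding basis_law_def by (subst AE_distr_iff) (auto simp: violation_bounds)
qed

lemma prob_basis:
  assumes "finite I" "J \<subseteq> I" and B: "B \<in> sets borel"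
  shows "measure (Pow_measure I) {z \<in> space (Pow_measure I). basis I J z \<and> violation (z ` J) \<in> B}
    = (\<integral>v. indicator B v * (1 - v) ^ (card I - card J) \<partial>basis_law (card J))"
proof -
  interpret F: finite_measure "basis_law (card J)" by (rule finite_measure_basis_law)
  have "(\<integral>\<^sup>+v. indicator B v * ennreal ((1 - v) ^ (card I - card J)) \<partial>basis_law (card J))
      = (\<integral>\<^sup>+v. ennreal (indicator B v * (1 - v) ^ (card I - card J)) \<partial>basis_law (card J))"
    by (intro nn_integral_cong) (simp add: indicator_def)
  moreover have "integral\<^sup>L (basis_law (card J)) (\<lambda>v. indicator B v * (1 - v) ^ (card I - card J))
    = enn2real (\<integral>\<^sup>+v. ennreal (indicator B v * (1 - v) ^ (card I - card J)) \<partial>basis_law (card J))"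
  proof (intro integral_eq_nn_integral)
    show "AE v in basis_law (card J). 0 \<le> indicator B v * (1 - v) ^ (card I - card J)"
      using AE_basis_law[of "card J"] by eventually_elim (simp add: indicator_def)
  qed (use B in measurable)
  ultimately show ?thesis
    unfolding measure_def emeasure_basis'[OF assms] by simp
qed

lemma sum_over_bases:
  fixes g :: "nat \<Rightarrow> real"
  shows "(\<Sum>J | J \<subseteq> {..<m} \<and> card J \<le> d. g (card J)) = (\<Sum>k\<le>d. real (m choose k) * g k)"
proof -
  have "(\<Sum>J | J \<subseteq> {..<m} \<and> card J \<le> d. g (card J))
      = (\<Sum>k\<in>{..d}. \<Sum>J | J \<in> {J. J \<subseteq> {..<m} \<and> card J \<le> d} \<and> card J = k. g (card J))"
    by (rule sum.group[symmetric]) auto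
  also have "\<dots> = (\<Sum>k\<le>d. real (m choose k) * g k)"
  proof (rule sum.cong[OF refl])
    fix k assume "k \<in> {..d}"
    then have "{J. J \<in> {J. J \<subseteq> {..<m} \<and> card J \<le> d} \<and> card J = k} = {J. J \<subseteq> {..<m} \<and> card J = k}"
      by auto
    then show "(\<Sum>J | J \<in> {J. J \<subseteq> {..<m} \<and> card J \<le> d} \<and> card J = k. g (card J)) = real (m choose k) * g k"
      using n_subsets[of "{..<m}" k] by simp
  qed
  finally show ?thesis .
qed

text \<open>Almost surely exactly one of the sets \<open>J\<close> with at most \<open>d\<close>
  indices is a basis of \<open>m\<close> draws, so their probabilities sum to 1. Since the laws do
  not depend on \<open>m\<close>, this gives infinitely many linear conditions on the same
  measures.\<close>

lemma basis_law_moments: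
  "(\<Sum>k\<le>d. real (m choose k) * (\<integral>v. (1 - v) ^ (m - k) \<partial>basis_law k)) = 1"
proof -
  let ?I = "{..<m}"
  let ?S = "{J. J \<subseteq> ?I \<and> card J \<le> d}"
  interpret PI: prob_space "Pow_measure ?I" by (rule prob_space_Pow_measure)
  let ?E = "\<lambda>J. {z \<in> space (Pow_measure ?I). basis ?I J z}"
  have E: "?E J \<in> sets (Pow_measure ?I)" for J
    using sets_basis[of ?I J] by (simp add: pred_def)
  have fin: "finite ?S" by (rule finite_subset[of _ "Pow ?I"]) auto
  have "AE z in Pow_measure ?I. (\<Sum>J\<in>?S. indicator (?E J) z) = (1 :: real)"
    using AE_basis_unique[OF finite_lessThan, of m] AE_space
  proof eventually_elim
    case (elim z)
    obtain J where J: "basis ?I J z" "card J \<le> d" using basis_exists[of ?I z] by auto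
    have "(\<Sum>K\<in>?S. indicator (?E K) z) = (\<Sum>K\<in>?S. if K = J then 1 else (0 :: real))"
      using elim J by (intro sum.cong) (auto simp: indicator_def)
    also have "\<dots> = 1" using fin J by (simp add: basis_def)
    finally show ?case .
  qed
  then have "(\<integral>z. (\<Sum>J\<in>?S. indicator (?E J) z) \<partial>Pow_measure ?I) = (\<integral>z. (1::real) \<partial>Pow_measure ?I)"
    using E by (intro integral_cong_AE) auto
  then have "1 = (\<Sum>J\<in>?S. measure (Pow_measure ?I) (?E J))"
    using E by (simp add: PI.emeasure_eq_measure PI.prob_space)
  also have "\<dots> = (\<Sum>J\<in>?S. \<integral>v. (1 - v) ^ (m - card J) \<partial>basis_law (card J))"
    using prob_basis[of ?I _ UNIV] by (intro sum.cong) auto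
  also have "\<dots> = (\<Sum>k\<le>d. real (m choose k) * (\<integral>v. (1 - v) ^ (m - k) \<partial>basis_law k))"
    by (rule sum_over_bases)
  finally show ?thesis by simp
qed

text \<open>A constraint that leaves the value of the basis unchanged can be added together with the
  whole sample by locality, hence it leaves the value of the sample unchanged. So both are violated
  by the same constraints.\<close>

lemma violation_basis:
  assumes "finite I" "basis I J z"
  shows "violation (z ` I) = violation (z ` J)"
proof -
  have J: "J \<subseteq> I" "f (z ` J) = f (z ` I)" and fin: "finite J"
    using assms finite_subset by (auto simp: basis_def)
  have "f (z ` I) < f (insert w (z ` I)) \<longleftrightarrow> f (z ` J) < f (insert w (z ` J))" for w
  proof
    assume "f (z ` J) < f (insert w (z ` J))"
    moreover have "f (insert w (z ` J)) \<le> f (insert w (z ` I))"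
      using J assms by (intro mono) auto
    ultimately show "f (z ` I) < f (insert w (z ` I))" using J by simp
  next
    assume *: "f (z ` I) < f (insert w (z ` I))"
    show "f (z ` J) < f (insert w (z ` J))"
    proof (rule ccontr)
      assume "\<not> f (z ` J) < f (insert w (z ` J))"
      then have "f (insert w (z ` J)) = f (z ` J)"
        using mono[OF _ subset_insertI[of "z ` J" w]] fin by auto
      moreover have "f (insert (z i) (z ` J)) = f (z ` J)" if "i \<in> I" for i
      proof -
        have "f (z ` J) \<le> f (insert (z i) (z ` J))" "f (insert (z i) (z ` J)) \<le> f (z ` I)"
          using J assms that fin by (intro mono; blast)+
        then show ?thesis using J by simp
      qed
      ultimately have "f (z ` J \<union> insert w (z ` I)) = f (z ` J)"
        using assms fin by (intro locality) auto
      moreover have "z ` J \<union> insert w (z ` I) = insert w (z ` I)" using J by auto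
      ultimately show False using * J by simp
    qed
  qed
  then show ?thesis unfolding violation_def by simp
qed

text \<open>A large violation probability of the sample is one of its basis. Summing over the
  possible bases gives the objective of the linear program bounded in
  \<open>binomial_tail_duality\<close>.\<close>

theorem violation_tail:
  assumes "d \<le> N" "1 \<le> d" "0 \<le> \<delta>'" "\<delta>' < \<delta>" "\<delta> \<le> 1"
  shows "measure (Pow_measure {..<N}) {z \<in> space (Pow_measure {..<N}). \<delta> \<le> violation (z ` {..<N})} \<le> binomial_tail N d \<delta>'"
proof -
  let ?I = "{..<N}"
  let ?S = "{J. J \<subseteq> ?I \<and> card J \<le> d}"
  interpret PI: prob_space "Pow_measure ?I" by (rule prob_space_Pow_measure)
  let ?E = "\<lambda>J. {z \<in> space (Pow_measure ?I). basis ?I J z \<and> violation (z ` J) \<in> {\<delta>..}}"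
  have E: "?E J \<in> sets (Pow_measure ?I)" if "J \<subseteq> ?I" for J
  proof -
    have [measurable]: "(\<lambda>z. violation (z ` J)) \<in> borel_measurable (Pow_measure ?I)"
      "Measurable.pred (Pow_measure ?I) (basis ?I J)"
      using that by (auto intro!: measurable_violation_subset sets_basis)
    show ?thesis by measurable
  qed
  have fin: "finite ?S" by (rule finite_subset[of _ "Pow ?I"]) auto
  have "{z \<in> space (Pow_measure ?I). \<delta> \<le> violation (z ` ?I)} \<subseteq> (\<Union>J\<in>?S. ?E J)"
  proof safe
    fix z assume z: "z \<in> space (Pow_measure ?I)" "\<delta> \<le> violation (z ` ?I)"
    obtain J where J: "basis ?I J z" "card J \<le> d" using basis_exists[of ?I z] by auto
    then show "z \<in> (\<Union>J\<in>?S. ?E J)"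
      using z violation_basis[of ?I J z] by (auto simp: basis_def)
  qed
  then have "measure (Pow_measure ?I) {z \<in> space (Pow_measure ?I). \<delta> \<le> violation (z ` ?I)} \<le> measure (Pow_measure ?I) (\<Union>J\<in>?S. ?E J)"
    using fin E by (intro PI.finite_measure_mono sets.finite_UN) auto
  also have "\<dots> \<le> (\<Sum>J\<in>?S. measure (Pow_measure ?I) (?E J))"
    using fin E by (intro PI.finite_measure_subadditive_finite) auto
  also have "\<dots> = (\<Sum>J\<in>?S. \<integral>v. indicator {\<delta>..} v * (1 - v) ^ (N - card J) \<partial>basis_law (card J))"
    using prob_basis[of ?I _ "{\<delta>..}"] by (intro sum.cong) auto
  also have "\<dots> = (\<Sum>k\<le>d. real (N choose k) * (\<integral>v. indicator {\<delta>..} v * (1 - v) ^ (N - k) \<partial>basis_law k))"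
    by (rule sum_over_bases)
  also have "\<dots> \<le> binomial_tail N d \<delta>'"
    using assms by (intro binomial_tail_duality basis_law_moments finite_measure_basis_law AE_basis_law) auto
  finally show ?thesis .
qed

end

section \<open>Convex scenario programs\<close>

lemma infdist_less_iff:
  assumes "C \<noteq> {}"
  shows "infdist x C < r \<longleftrightarrow> (\<exists>y\<in>C. dist x y < r)"
  unfolding infdist_notempty[OF assms]
  using assms by (intro cINF_less_iff) (auto intro: bdd_belowI[of _ 0])

text \<open>Nearly nearest points replace nearest ones, which may fail to exist when
  \<open>C\<close> is not closed; the slack \<open>e\<close> is removed at the end.\<close>

lemma convex_infdist_combination:
  fixes C :: "'x::real_normed_vector set"
  assumes C: "convex C" "C \<noteq> {}" and l: "0 \<le> l" "l \<le> 1"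
  shows "infdist ((1 - l) *\<^sub>R x + l *\<^sub>R y) C \<le> (1 - l) * infdist x C + l * infdist y C"
proof (rule field_le_epsilon)
  fix e :: real assume e: "0 < e"
  obtain a b where a: "a \<in> C" "dist x a < infdist x C + e" and b: "b \<in> C" "dist y b < infdist y C + e"
    using infdist_less_iff[OF C(2), of x "infdist x C + e"] infdist_less_iff[OF C(2), of y "infdist y C + e"] e by auto
  have "(1 - l) *\<^sub>R a + l *\<^sub>R b \<in> C"
    using C a b l by (intro convexD) auto
  then have "infdist ((1 - l) *\<^sub>R x + l *\<^sub>R y) C \<le> dist ((1 - l) *\<^sub>R x + l *\<^sub>R y) ((1 - l) *\<^sub>R a + l *\<^sub>R b)"
    by (rule infdist_le)
  also have "\<dots> = norm ((1 - l) *\<^sub>R (x - a) + l *\<^sub>R (y - b))"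
    by (simp add: dist_norm algebra_simps)
  also have "\<dots> \<le> (1 - l) * dist x a + l * dist y b"
    using l by (intro norm_triangle_le) (simp add: dist_norm)
  also have "\<dots> \<le> (1 - l) * (infdist x C + e) + l * (infdist y C + e)"
    using a b l by (intro add_mono mult_left_mono) auto
  finally show "infdist ((1 - l) *\<^sub>R x + l *\<^sub>R y) C \<le> (1 - l) * infdist x C + l * infdist y C + e"
    by (simp add: algebra_simps)
qed

text \<open>A convex set with interior points lies in the closure of its interior, so an open set
  that meets it also meets the interior. This permits countable unions in the measurability
  proofs.\<close>

lemma dense_meets_convex:
  fixes S :: "'x::euclidean_space set"
  assumes dense: "\<And>U. open U \<Longrightarrow> U \<noteq> {} \<Longrightarrow> \<exists>d\<in>D. d \<in> U"
    and S: "convex S" "interior S \<noteq> {}" and V: "open V" "x \<in> V" "x \<in> S"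
  shows "\<exists>d\<in>D. d \<in> S \<and> d \<in> V"
proof -
  have "x \<in> closure (interior S)"
    using S V closure_subset[of S] by (auto simp: convex_closure_interior)
  then have "interior S \<inter> V \<noteq> {}"
    using V open_Int_closure_eq_empty[of V "interior S"] by blast
  then obtain d where "d \<in> D" "d \<in> interior S \<inter> V"
    using dense[of "interior S \<inter> V"] V by auto
  then show ?thesis using interior_subset by blast
qed

text \<open>Helly's theorem gives \<open>DIM('x) + 1\<close> sets with empty intersection. One of
  them must be \<open>H\<close>, because the others have a common point; this leaves
  \<open>DIM('x)\<close> sets.\<close>

lemma Helly_basis:
  fixes S :: "'i \<Rightarrow> 'x::euclidean_space set"
  assumes A: "finite A" and conv: "\<And>a. a \<in> A \<Longrightarrow> convex (S a)" "convex H"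
    and ne: "(\<Inter>a\<in>A. S a) \<noteq> {}" and empty: "H \<inter> (\<Inter>a\<in>A. S a) = {}"
  shows "\<exists>B\<subseteq>A. card B \<le> DIM('x) \<and> H \<inter> (\<Inter>a\<in>B. S a) = {}"
proof (cases "card (S ` A) \<le> DIM('x)")
  case True
  \<comment> \<open>With so few distinct sets, one index for each set is enough.\<close>
  obtain B where "B \<subseteq> A" "inj_on S B" "S ` A = S ` B"
    using subset_image_inj[of "S ` A" S A] by auto
  then show ?thesis
    using True empty by (intro exI[of _ B]) (simp add: card_image)
next
  case False
  define F where "F = insert H (S ` A)"
  have "card (S ` A) \<le> card F"
    using A by (intro card_mono) (auto simp: F_def)
  then have F: "finite F" "card F \<ge> DIM('x) + 1" "\<forall>s\<in>F. convex s" "\<Inter>F = {}"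
    using False A conv empty by (auto simp: F_def)
  then obtain t where t: "t \<subseteq> F" "card t = DIM('x) + 1" "\<Inter>t = {}"
    using Helly[of F] by blast
  have "H \<in> t"
  proof (rule ccontr)
    assume "H \<notin> t"
    then have "t \<subseteq> S ` A" using t by (auto simp: F_def)
    then have "(\<Inter>a\<in>A. S a) \<subseteq> \<Inter>t" by auto
    then show False using t ne by auto
  qed
  have "t - {H} \<subseteq> S ` A" using t by (auto simp: F_def)
  then obtain B where B: "B \<subseteq> A" "inj_on S B" "t - {H} = S ` B"
    using subset_image_inj[of "t - {H}" S A] by auto
  have "card B = card (t - {H})"
    using B by (simp add: card_image)
  also have "\<dots> = DIM('x)" using t \<open>H \<in> t\<close> by simp
  finally have "card B \<le> DIM('x)" by simp
  moreover have "H \<inter> (\<Inter>a\<in>B. S a) = \<Inter>t"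
    using \<open>H \<in> t\<close> B(3) by (metis Inter_insert insert_Diff)
  ultimately show ?thesis using B t by auto
qed

section \<open>The regularized program with relaxed constraints\<close>

locale relaxed_program =
  fixes C :: "'a \<Rightarrow> 'x::euclidean_space set" and c :: 'x and \<eta> :: real
  assumes convex_C: "convex (C \<xi>)"
    and interior_C: "finite A \<Longrightarrow> A \<noteq> {} \<Longrightarrow> interior (\<Inter>\<xi>\<in>A. C \<xi>) \<noteq> {}"
    and eta_pos: "0 < \<eta>"
begin

text \<open>The quadratic term makes the objective coercive and strictly convex. It carries the same
  factor \<eta> as the relaxations, so that one limit removes both perturbations.\<close>

definition obj :: "'x \<Rightarrow> real" where
  "obj x = c \<bullet> x + \<eta> * (x \<bullet> x)"

text \<open>A closed neighbourhood of the constraint set, closed even if the set is not. Negative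
  amounts count as 0 because \<open>random_lp\<close> speaks of all finite sets of pairs.\<close>

definition relaxed :: "'a \<times> real \<Rightarrow> 'x set" where
  "relaxed z = {x. infdist x (C (fst z)) \<le> \<eta> * max 0 (snd z)}"

definition region :: "('a \<times> real) set \<Rightarrow> 'x set" where
  "region A = (\<Inter>z\<in>A. relaxed z)"

definition opt :: "('a \<times> real) set \<Rightarrow> real" where
  "opt A = Inf (obj ` region A)"

lemma interior_C1: "interior (C \<xi>) \<noteq> {}" and C_nonempty: "C \<xi> \<noteq> {}"
proof -
  show "interior (C \<xi>) \<noteq> {}" using interior_C[of "{\<xi>}"] by simp
  then show "C \<xi> \<noteq> {}" using interior_subset[of "C \<xi>"] by auto
qed

lemma C_subset_relaxed: "C (fst z) \<subseteq> relaxed z"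
  using eta_pos by (auto simp: relaxed_def)

lemma convex_relaxed_combination:
  assumes "infdist x (C \<xi>) \<le> \<eta> * s" "infdist y (C \<xi>) \<le> \<eta> * t" "0 \<le> l" "l \<le> 1"
  shows "infdist ((1 - l) *\<^sub>R x + l *\<^sub>R y) (C \<xi>) \<le> \<eta> * ((1 - l) * s + l * t)"
proof -
  have "infdist ((1 - l) *\<^sub>R x + l *\<^sub>R y) (C \<xi>) \<le> (1 - l) * infdist x (C \<xi>) + l * infdist y (C \<xi>)"
    using assms by (intro convex_infdist_combination convex_C C_nonempty)
  also have "\<dots> \<le> (1 - l) * (\<eta> * s) + l * (\<eta> * t)"
    using assms by (intro add_mono mult_left_mono) auto
  finally show ?thesis by (simp add: algebra_simps)
qed

lemma convex_relaxed: "convex (relaxed z)"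
proof (rule convexI)
  fix x y :: 'x and u v :: real
  assume "x \<in> relaxed z" "y \<in> relaxed z" and uv: "0 \<le> u" "0 \<le> v" "u + v = 1"
  then have "infdist ((1 - v) *\<^sub>R x + v *\<^sub>R y) (C (fst z)) \<le> \<eta> * ((1 - v) * max 0 (snd z) + v * max 0 (snd z))"
    by (intro convex_relaxed_combination) (auto simp: relaxed_def)
  moreover have "1 - v = u" using uv by simp
  ultimately show "u *\<^sub>R x + v *\<^sub>R y \<in> relaxed z"
    using uv by (simp add: relaxed_def flip: distrib_right)
qed

lemma closed_relaxed: "closed (relaxed z)"
  unfolding relaxed_def by (intro closed_Collect_le continuous_intros)

lemma convex_region: "convex (region A)"
  unfolding region_def by (intro convex_INT convex_relaxed)

lemma closed_region: "closed (region A)"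
  unfolding region_def by (intro closed_INT ballI closed_relaxed)

lemma interior_region: "finite A \<Longrightarrow> interior (region A) \<noteq> {}"
proof (cases "A = {}")
  case False
  assume A: "finite A"
  have "(\<Inter>\<xi>\<in>fst ` A. C \<xi>) \<subseteq> region A"
    unfolding region_def using C_subset_relaxed by blast
  then show ?thesis
    using interior_C[of "fst ` A"] A False interior_mono by blast
qed (simp add: region_def)

lemma region_nonempty: "finite A \<Longrightarrow> region A \<noteq> {}"
  using interior_region[of A] interior_subset[of "region A"] by auto

lemma region_antimono: "A \<subseteq> B \<Longrightarrow> region B \<subseteq> region A"
  unfolding region_def by auto

lemma continuous_obj: "continuous_on S obj"
  unfolding obj_def[abs_def] by (intro continuous_intros)

text \<open>The last term quantifies strict convexity and yields uniqueness of minimizers at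
  midpoints.\<close>

lemma obj_combination:
  "obj ((1 - l) *\<^sub>R x + l *\<^sub>R y) = (1 - l) * obj x + l * obj y - \<eta> * (l * (1 - l)) * ((x - y) \<bullet> (x - y))"
  unfolding obj_def by (simp add: inner_simps inner_commute) (simp add: algebra_simps)

lemma convex_obj:
  assumes "0 \<le> l" "l \<le> 1"
  shows "obj ((1 - l) *\<^sub>R x + l *\<^sub>R y) \<le> (1 - l) * obj x + l * obj y"
  unfolding obj_combination using assms eta_pos by simp

lemma convex_obj_less: "convex {x. obj x < v}"
proof (rule convexI)
  fix x y :: 'x and a b :: real
  assume xy: "x \<in> {x. obj x < v}" "y \<in> {x. obj x < v}" and ab: "0 \<le> a" "0 \<le> b" "a + b = 1"
  have "obj ((1 - b) *\<^sub>R x + b *\<^sub>R y) \<le> (1 - b) * obj x + b * obj y"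
    using ab by (intro convex_obj) auto
  also have "\<dots> < v"
    using xy ab by (intro convex_bound_lt) auto
  finally show "a *\<^sub>R x + b *\<^sub>R y \<in> {x. obj x < v}"
    using ab by (simp add: eq_diff_eq[symmetric])
qed

lemma bounded_obj_le: "bounded {x. obj x \<le> v}"
proof -
  \<comment> \<open>Beyond this radius, \<open>\<eta> * norm x\<close> exceeds
    \<open>norm c + 1 + \<bar>v\<bar>\<close> and \<open>norm x\<close> exceeds 1, so the quadratic
    term outweighs both the linear term and \<open>v\<close>.\<close>
  define B where "B = (norm c + 1 + \<bar>v\<bar>) / \<eta> + 1"
  have "norm x \<le> B" if "obj x \<le> v" for x
  proof (rule ccontr)
    assume "\<not> norm x \<le> B"
    then have n: "B < norm x" by simp
    have B1: "1 \<le> B" using eta_pos by (simp add: B_def)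
    have "norm c + 1 + \<bar>v\<bar> < \<eta> * norm x"
      using n eta_pos by (simp add: B_def field_simps)
    then have "(norm c + 1 + \<bar>v\<bar>) * norm x < \<eta> * norm x * norm x"
      using n B1 by (intro mult_strict_right_mono) auto
    moreover have "- (norm c * norm x) \<le> c \<bullet> x"
      using Cauchy_Schwarz_ineq2[of c x] by (simp add: abs_le_iff)
    moreover have "\<bar>v\<bar> * 1 \<le> \<bar>v\<bar> * norm x" using n B1 by (intro mult_left_mono) auto
    moreover have "obj x = c \<bullet> x + \<eta> * norm x * norm x"
      by (simp add: obj_def dot_square_norm power2_eq_square)
    ultimately have "\<bar>v\<bar> + norm x < obj x"
      by (simp add: algebra_simps)
    then show False using that n B1 by auto
  qed
  then show ?thesis by (auto intro: boundedI)
qed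

lemma minimizer_exists:
  assumes "finite A"
  obtains x where "x \<in> region A" "obj x = opt A" "\<And>y. y \<in> region A \<Longrightarrow> opt A \<le> obj y"
proof -
  obtain x0 where x0: "x0 \<in> region A" using region_nonempty[OF assms] by auto
  let ?S = "region A \<inter> {x. obj x \<le> obj x0}"
  have "closed {x. obj x \<le> obj x0}"
    by (intro closed_Collect_le continuous_intros continuous_obj)
  then have "compact ?S"
    using bounded_obj_le[of "obj x0"] closed_region[of A]
    by (auto simp: compact_eq_bounded_closed intro: bounded_subset closed_Int)
  then obtain x where x: "x \<in> ?S" "\<forall>y\<in>?S. obj x \<le> obj y"
    using continuous_attains_inf[of ?S obj] x0 continuous_obj by auto
  then have min: "obj x \<le> obj y" if "y \<in> region A" for y
    using that by (cases "obj y \<le> obj x0") (blast, use x(1) in simp)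
  have "opt A = obj x"
    unfolding opt_def using x min by (intro cInf_eq_minimum) auto
  then show ?thesis using that x min by auto
qed

lemma opt_le: "finite A \<Longrightarrow> x \<in> region A \<Longrightarrow> opt A \<le> obj x"
  using minimizer_exists by metis

lemma minimizer_unique:
  assumes "finite A" "x \<in> region A" "y \<in> region A" "obj x = opt A" "obj y = opt A"
  shows "x = y"
proof (rule ccontr)
  assume "x \<noteq> y"
  let ?m = "(1 - 1/2) *\<^sub>R x + (1/2) *\<^sub>R y"
  have "?m \<in> region A"
    using assms by (intro convexD[OF convex_region]) auto
  then have "opt A \<le> obj ?m" by (intro opt_le assms)
  also have "\<dots> = (1 - 1/2) * opt A + 1/2 * opt A - \<eta> * (1/2 * (1 - 1/2)) * ((x - y) \<bullet> (x - y))"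
    unfolding obj_combination using assms by simp
  also have "\<dots> < opt A"
    using \<open>x \<noteq> y\<close> eta_pos by simp
  finally show False by simp
qed

lemma opt_mono: 
  assumes "finite B" "A \<subseteq> B"
  shows "opt A \<le> opt B"
proof -
  obtain x where "x \<in> region B" "obj x = opt B" using minimizer_exists assms by metis
  then show ?thesis
    using opt_le[of A x] region_antimono[OF assms(2)] assms finite_subset by auto
qed

text \<open>If \<open>w\<close> does not raise the value, the minimizer with \<open>w\<close> also
  minimizes over \<open>A\<close>. By uniqueness it is the minimizer of \<open>A\<close>, which
  therefore satisfies every constraint in \<open>T\<close>.\<close>

lemma opt_locality:
  assumes "finite A" "finite T" "\<And>w. w \<in> T \<Longrightarrow> opt (insert w A) = opt A"
  shows "opt (A \<union> T) = opt A"
proof -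
  obtain x where x: "x \<in> region A" "obj x = opt A" using minimizer_exists assms by metis
  have "x \<in> relaxed w" if w: "w \<in> T" for w
  proof -
    obtain y where y: "y \<in> region (insert w A)" "obj y = opt (insert w A)"
      using minimizer_exists[of "insert w A"] assms(1) by (metis finite_insert)
    then have "y \<in> region A" using region_antimono[of A "insert w A"] by auto
    then have "x = y" using minimizer_unique[of A x y] assms x y w by auto
    then show ?thesis using y by (auto simp: region_def)
  qed
  then have "x \<in> region (A \<union> T)" using x by (auto simp: region_def)
  then have "opt (A \<union> T) \<le> opt A" using opt_le[of "A \<union> T" x] x assms by auto
  then show ?thesis using opt_mono[of "A \<union> T" A] assms by auto
qed

text \<open>The points better than \<open>opt A\<close> form a convex set that misses the region;
  Helly keeps at most \<open>DIM('x)\<close> constraints that already exclude them.\<close>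

lemma opt_small_basis:
  assumes "finite A"
  shows "\<exists>B\<subseteq>A. card B \<le> DIM('x) \<and> opt B = opt A"
proof -
  have "{x. obj x < opt A} \<inter> (\<Inter>z\<in>A. relaxed z) = {}"
    using opt_le[OF assms] unfolding region_def by (auto simp: disjoint_iff not_less[symmetric])
  then obtain B where B: "B \<subseteq> A" "card B \<le> DIM('x)" "{x. obj x < opt A} \<inter> (\<Inter>z\<in>B. relaxed z) = {}"
    using Helly_basis[of A relaxed "{x. obj x < opt A}"] assms convex_relaxed convex_obj_less region_nonempty[OF assms]
    unfolding region_def by metis
  have fin: "finite B" using assms B finite_subset by blast
  obtain x where x: "x \<in> region B" "obj x = opt B" using minimizer_exists[OF fin] by metis
  then have "opt A \<le> opt B" using B(3) unfolding region_def by (metis (mono_tags, lifting) disjoint_iff mem_Collect_eq not_less)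
  then show ?thesis using opt_mono[OF assms B(1)] B by auto
qed

text \<open>The value is a convex function of the relaxation \<open>u\<close> and falls to
  \<open>opt A < v\<close> for large \<open>u\<close>. A convex function that equals
  \<open>v\<close> at \<open>u1\<close> and lies below \<open>v\<close> further right is below
  \<open>v\<close> at every point in between, in particular at \<open>u2\<close>.\<close>

lemma opt_hits_value_once:
  assumes A: "finite A" and u: "0 \<le> u1" "u1 < u2"
    and h: "opt A < v" "opt (insert (\<xi>, u1) A) = v" "opt (insert (\<xi>, u2) A) = v"
  shows False
proof -
  obtain x where x: "x \<in> region A" "obj x = opt A" using minimizer_exists A by metis
  obtain y where y: "y \<in> region (insert (\<xi>, u1) A)" "obj y = v"
    using minimizer_exists[of "insert (\<xi>, u1) A"] A h by auto
  \<comment> \<open>At this relaxation the minimizer \<open>x\<close> of \<open>A\<close> satisfies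
    the new constraint.\<close>
  define u3 where "u3 = max (u2 + 1) (infdist x (C \<xi>) / \<eta>)"
  have u3: "u2 < u3" "infdist x (C \<xi>) \<le> \<eta> * u3"
    using eta_pos by (auto simp: u3_def field_simps max_def)
  \<comment> \<open>The weight that writes \<open>u2\<close> as a convex combination of
    \<open>u1\<close> and \<open>u3\<close>.\<close>
  define l where "l = (u2 - u1) / (u3 - u1)"
  have l: "0 < l" "l \<le> 1" using u u3 by (auto simp: l_def field_simps)
  have lu: "(1 - l) * u1 + l * u3 = u2"
  proof -
    have "l * (u3 - u1) = u2 - u1" using u u3 by (simp add: l_def)
    then show ?thesis by (simp add: algebra_simps)
  qed
  let ?m = "(1 - l) *\<^sub>R y + l *\<^sub>R x"
  have "?m \<in> region A"
    using x y l region_antimono[of A "insert (\<xi>, u1) A"] by (intro convexD[OF convex_region]) auto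
  moreover have "infdist ?m (C \<xi>) \<le> \<eta> * ((1 - l) * u1 + l * u3)"
    using y u u3 l by (intro convex_relaxed_combination) (auto simp: region_def relaxed_def)
  then have "?m \<in> relaxed (\<xi>, u2)"
    unfolding lu using u by (simp add: relaxed_def)
  ultimately have "v \<le> obj ?m"
    using opt_le[of "insert (\<xi>, u2) A" ?m] A h by (auto simp: region_def)
  also have "\<dots> \<le> (1 - l) * v + l * opt A"
    using convex_obj[of l y x] l x y by auto
  also have "\<dots> < (1 - l) * v + l * v"
    using l h by simp
  finally show False by (simp add: algebra_simps)
qed

text \<open>With a countable \<open>D\<close> this shows that the value is measurable: a point
  better than \<open>v\<close> can be moved into \<open>D\<close>, since the sublevel set is open
  and the region is convex with interior.\<close>

lemma opt_less_iff_dense: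
  assumes dense: "\<And>U. open U \<Longrightarrow> U \<noteq> {} \<Longrightarrow> \<exists>d\<in>D. d \<in> U" and A: "finite A"
  shows "opt A < v \<longleftrightarrow> (\<exists>x\<in>D. obj x < v \<and> (\<forall>z\<in>A. x \<in> relaxed z))"
proof
  assume "opt A < v"
  then obtain x where x: "x \<in> region A" "obj x < v" using minimizer_exists A by metis
  have "open {x. obj x < v}" by (intro open_Collect_less continuous_intros continuous_obj)
  from dense_meets_convex[OF dense convex_region interior_region[OF A] this _ x(1)] x
  show "\<exists>x\<in>D. obj x < v \<and> (\<forall>z\<in>A. x \<in> relaxed z)" by (auto simp: region_def)
next
  assume "\<exists>x\<in>D. obj x < v \<and> (\<forall>z\<in>A. x \<in> relaxed z)"
  then show "opt A < v" using opt_le[OF A] by (fastforce simp: region_def)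
qed

lemma infdist_less_iff_dense:
  assumes dense: "\<And>U. open U \<Longrightarrow> U \<noteq> {} \<Longrightarrow> \<exists>d\<in>D. d \<in> U"
  shows "infdist x (C \<xi>) < r \<longleftrightarrow> (\<exists>y\<in>D. dist x y < r \<and> y \<in> C \<xi>)"
proof
  assume "infdist x (C \<xi>) < r"
  then obtain y where y: "y \<in> C \<xi>" "dist x y < r"
    unfolding infdist_less_iff[OF C_nonempty] by auto
  from dense_meets_convex[OF dense convex_C interior_C1 open_ball[of x r] _ y(1)] y
  show "\<exists>y\<in>D. dist x y < r \<and> y \<in> C \<xi>" by auto
next
  assume "\<exists>y\<in>D. dist x y < r \<and> y \<in> C \<xi>"
  then show "infdist x (C \<xi>) < r" unfolding infdist_less_iff[OF C_nonempty] by auto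
qed

text \<open>The linear lower bound rests on shrinking a relaxed point towards the centre of a ball
  contained in all constraints.\<close>

lemma opt_lower_bound:
  assumes A: "finite A" "A \<noteq> {}" and ball: "0 < r" "\<And>z. z \<in> A \<Longrightarrow> cball x0 r \<subseteq> C (fst z)"
    and U: "0 \<le> U" "\<And>z. z \<in> A \<Longrightarrow> max 0 (snd z) \<le> U"
    and L: "\<And>y. (\<And>z. z \<in> A \<Longrightarrow> y \<in> C (fst z)) \<Longrightarrow> L \<le> c \<bullet> y"
  shows "L + \<eta> * ((U + 1) * (L - c \<bullet> x0) / r) \<le> opt A"
proof -
  obtain x where x: "x \<in> region A" "obj x = opt A" using minimizer_exists A by metis
  \<comment> \<open>The additional 1 puts \<rho> strictly above every relaxation, so that a point of
    the constraint set lies within distance less than \<rho>.\<close>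
  define \<rho> where "\<rho> = \<eta> * (U + 1)"
  have \<rho>: "0 < \<rho>" using eta_pos U by (simp add: \<rho>_def)
  \<comment> \<open>This weight satisfies \<open>(1 - t) * \<rho> = t * r\<close>: the ball around
    \<open>x0\<close> can just absorb the violation of \<open>x\<close>.\<close>
  define t where "t = \<rho> / (\<rho> + r)"
  have t: "0 < t" "t < 1" "t * (\<rho> + r) = \<rho>" "(1 - t) * (\<rho> + r) = r"
    using \<rho> ball by (auto simp: t_def field_simps)
  have tr: "(1 - t) * \<rho> = t * r" using t by (simp add: algebra_simps)
  have "(1 - t) *\<^sub>R x + t *\<^sub>R x0 \<in> C (fst z)" if z: "z \<in> A" for z
  proof -
    have "infdist x (C (fst z)) \<le> \<eta> * max 0 (snd z)"
      using x z by (auto simp: region_def relaxed_def)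
    also have "\<dots> \<le> \<eta> * U" using U(2)[OF z] eta_pos by (intro mult_left_mono) auto
    also have "\<dots> < \<rho>" using eta_pos by (simp add: \<rho>_def)
    finally obtain y where y: "y \<in> C (fst z)" "dist x y < \<rho>"
      unfolding infdist_less_iff[OF C_nonempty] by auto
    \<comment> \<open>The displacement of the centre that compensates replacing \<open>x\<close> by
      the feasible point \<open>y\<close>.\<close>
    define e where "e = ((1 - t) / t) *\<^sub>R (x - y)"
    have "norm e = (1 - t) * norm (x - y) / t" using t by (simp add: e_def)
    also have "\<dots> \<le> (1 - t) * \<rho> / t"
      using y t by (intro divide_right_mono mult_left_mono) (auto simp: dist_norm)
    also have "\<dots> = r" using tr t by simp
    finally have "x0 + e \<in> cball x0 r" by (simp add: dist_norm)
    then have "x0 + e \<in> C (fst z)" using ball(2)[OF z] by blast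
    then have "(1 - t) *\<^sub>R y + t *\<^sub>R (x0 + e) \<in> C (fst z)"
      using y t by (intro convexD[OF convex_C]) auto
    moreover have "t *\<^sub>R e = (1 - t) *\<^sub>R (x - y)" using t by (simp add: e_def)
    then have "(1 - t) *\<^sub>R y + t *\<^sub>R (x0 + e) = (1 - t) *\<^sub>R x + t *\<^sub>R x0"
      by (simp add: scaleR_right_diff_distrib scaleR_add_right)
    ultimately show ?thesis by simp
  qed
  then have "L \<le> c \<bullet> ((1 - t) *\<^sub>R x + t *\<^sub>R x0)" by (rule L)
  then have "L \<le> (1 - t) * (c \<bullet> x) + t * (c \<bullet> x0)" by (simp add: inner_simps)
  then have "L * (\<rho> + r) \<le> ((1 - t) * (c \<bullet> x) + t * (c \<bullet> x0)) * (\<rho> + r)"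
    using \<rho> ball by (intro mult_right_mono) auto
  also have "\<dots> = ((1 - t) * (\<rho> + r)) * (c \<bullet> x) + (t * (\<rho> + r)) * (c \<bullet> x0)"
    by (simp add: algebra_simps)
  also have "\<dots> = r * (c \<bullet> x) + \<rho> * (c \<bullet> x0)" unfolding t by simp
  finally have "L * r + \<rho> * (L - c \<bullet> x0) \<le> r * (c \<bullet> x)" by (simp add: algebra_simps)
  then have "L + \<rho> * (L - c \<bullet> x0) / r \<le> c \<bullet> x" using ball by (simp add: field_simps)
  also have "\<dots> \<le> opt A" using x(2)[symmetric] eta_pos by (simp add: obj_def)
  finally show ?thesis by (simp add: \<rho>_def algebra_simps)
qed

lemma opt_upper_bound:
  assumes "finite A" "\<And>z. z \<in> A \<Longrightarrow> x \<in> C (fst z)"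
  shows "opt A \<le> c \<bullet> x + \<eta> * (x \<bullet> x)"
  using opt_le[of A x] assms C_subset_relaxed by (fastforce simp: region_def obj_def)

end

section \<open>Random relaxations and their limit\<close>

abbreviation unit_uniform :: "real measure" where
  "unit_uniform \<equiv> uniform_measure lborel {0..1}"

lemma prob_space_unit_uniform: "prob_space unit_uniform"
  by (intro prob_space_uniform_measure) auto

lemma AE_unit_uniform_at_most_one:
  assumes "\<And>u1 u2. 0 \<le> u1 \<Longrightarrow> u1 < u2 \<Longrightarrow> Q u1 \<Longrightarrow> Q u2 \<Longrightarrow> False"
  shows "AE u in unit_uniform. \<not> Q u"
proof -
  have "\<exists>a. \<forall>u\<ge>0. Q u \<longrightarrow> u = a"
  proof (cases "\<exists>a\<ge>0. Q a")
    case True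
    then obtain a where "0 \<le> a" "Q a" by auto
    then show ?thesis using assms by (metis linorder_neqE_linordered_idom)
  qed auto
  then obtain a where a: "\<And>u. 0 \<le> u \<Longrightarrow> Q u \<Longrightarrow> u = a" by auto
  have "AE u in lborel. u \<noteq> a" by (rule AE_lborel_singleton)
  then have "AE u in lborel. u \<in> {0..1} \<longrightarrow> \<not> Q u"
    by eventually_elim (use a in auto)
  then show ?thesis by (intro AE_uniform_measureI) auto
qed

text \<open>Continuity from below: \<open>B\<close> is covered by the increasing sets of points that
  lie in all \<open>W k\<close> from some index on.\<close>

lemma measure_liminf_greater:
  assumes "finite_measure M" and W: "\<And>k. W k \<in> sets M"
    and sub: "\<And>x. x \<in> B \<Longrightarrow> \<forall>\<^sub>F k in sequentially. x \<in> W k" and B: "b < measure M B"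
  shows "\<forall>\<^sub>F k in sequentially. b < measure M (W k)"
proof -
  interpret finite_measure M by fact
  define V where "V n = (\<Inter>k\<in>{n..}. W k)" for n
  have V: "V n \<in> sets M" for n unfolding V_def using W by (intro sets.countable_INT) auto
  have "incseq V" unfolding V_def by (intro monoI) (auto simp: le_fun_def)
  then have lim: "(\<lambda>n. measure M (V n)) \<longlonglongrightarrow> measure M (\<Union>n. V n)"
    using V by (intro finite_Lim_measure_incseq) auto
  have "measure M B \<le> measure M (\<Union>n. V n)"
  proof (rule finite_measure_mono)
    show "B \<subseteq> (\<Union>n. V n)"
    proof
      fix x assume "x \<in> B"
      then obtain n where "\<forall>k\<ge>n. x \<in> W k" using sub[of x] unfolding eventually_sequentially by blast
      then show "x \<in> (\<Union>n. V n)" unfolding V_def by auto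
    qed
  qed (use V in auto)
  with B have "b < measure M (\<Union>n. V n)" by simp
  from order_tendstoD(1)[OF lim this] have "\<forall>\<^sub>F n in sequentially. b < measure M (V n)" .
  then show ?thesis
  proof eventually_elim
    case (elim n)
    have "measure M (V n) \<le> measure M (W n)"
      using W by (intro finite_measure_mono) (auto simp: V_def)
    with elim show ?case by simp
  qed
qed

context relaxed_program
begin

text \<open>The event that the value is below \<open>v\<close> is a countable union, over a dense
  set, of finite intersections of events about distances; these are countable unions in the same
  way.\<close>

lemma measurable_opt:
  assumes C: "\<And>x. {\<xi> \<in> space P. x \<in> C \<xi>} \<in> sets P"
    and J: "finite J" and g: "\<And>j. j \<in> J \<Longrightarrow> g j \<in> measurable N (P \<Otimes>\<^sub>M borel)"
  shows "(\<lambda>s. opt ((\<lambda>j. g j s) ` J)) \<in> borel_measurable N"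
proof -
  obtain D :: "'x set" where D: "countable D" "\<And>U. open U \<Longrightarrow> U \<noteq> {} \<Longrightarrow> \<exists>d\<in>D. d \<in> U"
    by (rule countable_dense_setE) blast
  have inf [measurable]: "(\<lambda>\<xi>. infdist x (C \<xi>)) \<in> borel_measurable P" for x
  proof (rule borel_measurableI_less)
    fix r
    have iff: "infdist x (C \<xi>) < r \<longleftrightarrow> (\<exists>y\<in>D. dist x y < r \<and> y \<in> C \<xi>)" for \<xi>
      by (rule infdist_less_iff_dense) (rule D(2))
    have "{\<xi> \<in> space P. infdist x (C \<xi>) < r} = (\<Union>y\<in>{y \<in> D. dist x y < r}. {\<xi> \<in> space P. y \<in> C \<xi>})"
      by (auto simp: iff)
    also have "\<dots> \<in> sets P" using D(1) C by (intro sets.countable_UN') auto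
    finally show "{\<xi> \<in> space P. infdist x (C \<xi>) < r} \<in> sets P" .
  qed
  have rel: "{s \<in> space N. x \<in> relaxed (g j s)} \<in> sets N" if "j \<in> J" for j x
  proof -
    have [measurable]: "g j \<in> measurable N (P \<Otimes>\<^sub>M borel)" using g that .
    show ?thesis unfolding relaxed_def mem_Collect_eq by measurable
  qed
  show ?thesis
  proof (rule borel_measurableI_less)
    fix v
    have "{s \<in> space N. opt ((\<lambda>j. g j s) ` J) < v}
       = (\<Union>x\<in>{x \<in> D. obj x < v}. {s \<in> space N. \<forall>j\<in>J. x \<in> relaxed (g j s)})"
      using J by (subst opt_less_iff_dense[OF D(2)]) auto
    also have "\<dots> \<in> sets N"
      using D(1) J rel by (intro sets.countable_UN' sets.sets_Collect_finite_All) auto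
    finally show "{s \<in> space N. opt ((\<lambda>j. g j s) ` J) < v} \<in> sets N" .
  qed
qed

lemma measurable_opt_insert:
  assumes C: "\<And>x. {\<xi> \<in> space P. x \<in> C \<xi>} \<in> sets P" and "space P = UNIV" "finite A"
  shows "(\<lambda>w. opt (insert w A)) \<in> borel_measurable (P \<Otimes>\<^sub>M borel)"
proof -
  \<comment> \<open>The index \<open>None\<close> carries the variable constraint, the indices
    \<open>Some a\<close> the fixed ones.\<close>
  have eq: "(\<lambda>j. case j of None \<Rightarrow> w | Some a \<Rightarrow> a) ` insert None (Some ` A) = insert w A" for w
    by (auto simp: image_iff)
  have "(\<lambda>w. opt ((\<lambda>j. case j of None \<Rightarrow> w | Some a \<Rightarrow> a) ` insert None (Some ` A))) \<in> borel_measurable (P \<Otimes>\<^sub>M borel)"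
    by (rule measurable_opt[OF C])
       (use assms in \<open>auto split: option.split simp: space_pair_measure\<close>)
  then show ?thesis unfolding eq .
qed

lemma random_lp_opt:
  assumes P: "prob_space P" "space P = UNIV" and C: "\<And>x. {\<xi> \<in> space P. x \<in> C \<xi>} \<in> sets P"
  shows "random_lp (P \<Otimes>\<^sub>M unit_uniform) opt DIM('x)"
proof -
  interpret P: prob_space P by fact
  interpret U: prob_space unit_uniform by (rule prob_space_unit_uniform)
  interpret PU: pair_prob_space P unit_uniform ..
  let ?M = "P \<Otimes>\<^sub>M unit_uniform"
  have sets_eq: "sets ?M = sets (P \<Otimes>\<^sub>M borel)" by (intro sets_pair_measure_cong) auto
  show ?thesis
  proof unfold_locales
    fix J :: "nat set" assume J: "finite J"
    show "(\<lambda>z. opt (z ` J)) \<in> borel_measurable (Pi\<^sub>M J (\<lambda>_. ?M))"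
    proof (rule measurable_opt[OF C J])
      show "(\<lambda>z. z j) \<in> measurable (Pi\<^sub>M J (\<lambda>_. ?M)) (P \<Otimes>\<^sub>M borel)" if "j \<in> J" for j
        using measurable_component_singleton[OF that, of "\<lambda>_. ?M"] sets_eq measurable_cong_sets by blast
    qed
  next
    fix A B :: "('a \<times> real) set" assume fin: "finite A" "finite B"
    have [measurable]: "(\<lambda>w. opt (insert w A)) \<in> borel_measurable ?M"
      using measurable_opt_insert[OF C P(2) fin(1)] sets_eq measurable_cong_sets by blast
    have [measurable]: "Measurable.pred ?M (\<lambda>w. opt (insert w A) = opt B)"
      using borel_measurable_eq[of "\<lambda>w. opt (insert w A)" ?M "\<lambda>_. opt B"] by (simp add: pred_def)
    \<comment> \<open>For each \<xi> at most one nonnegative relaxation hits the value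
      \<open>opt B\<close>; Fubini extends this to pairs.\<close>
    show "AE w in ?M. \<not> (opt A < opt (insert w A) \<and> opt (insert w A) = opt B)"
    proof (rule PU.AE_pair_measure)
      show "{w \<in> space ?M. \<not> (opt A < opt (insert w A) \<and> opt (insert w A) = opt B)} \<in> sets ?M"
        by measurable
      show "AE \<xi> in P. AE u in unit_uniform. \<not> (opt A < opt (insert (\<xi>, u) A) \<and> opt (insert (\<xi>, u) A) = opt B)"
        using opt_hits_value_once[OF fin(1), where v = "opt B"]
        by (intro AE_I2 AE_unit_uniform_at_most_one) metis
    qed
  qed (use opt_mono opt_locality opt_small_basis in auto)
qed

end

text \<open>As \<eta> tends to 0, the upper bound for \<open>A\<close> tends to
  \<open>c \<bullet> x\<close> and the lower bound for \<open>insert w A\<close> to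
  \<open>L\<close>. The relaxation amounts stay fixed, so the finitely many constraints share one
  bound \<open>U\<close> and one ball.\<close>

lemma relaxed_opt_strict_eventually:
  fixes C :: "'a \<Rightarrow> 'x::euclidean_space set"
  assumes conv: "\<And>\<xi>. convex (C \<xi>)"
    and inter: "\<And>A. finite A \<Longrightarrow> A \<noteq> {} \<Longrightarrow> interior (\<Inter>\<xi>\<in>A. C \<xi>) \<noteq> {}"
    and A: "finite A" and x: "\<And>z. z \<in> A \<Longrightarrow> x \<in> C (fst z)"
    and L: "\<And>y. (\<And>z. z \<in> insert w A \<Longrightarrow> y \<in> C (fst z)) \<Longrightarrow> L \<le> c \<bullet> y"
    and less: "c \<bullet> x < L"
  shows "\<forall>\<^sub>F k in sequentially. relaxed_program.opt C c (1 / real (Suc k)) A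
           < relaxed_program.opt C c (1 / real (Suc k)) (insert w A)"
proof -
  obtain x0 where "x0 \<in> interior (\<Inter>\<xi>\<in>fst ` insert w A. C \<xi>)"
    using inter[of "fst ` insert w A"] A by auto
  then obtain r where r: "0 < r" "cball x0 r \<subseteq> (\<Inter>\<xi>\<in>fst ` insert w A. C \<xi>)"
    unfolding mem_interior_cball by auto
  define U where "U = Max ((\<lambda>z. max 0 (snd z)) ` insert w A)"
  have U: "max 0 (snd z) \<le> U" if "z \<in> insert w A" for z
    unfolding U_def using that A by (intro Max_ge) auto
  then have U0: "0 \<le> U" using insertI1[of w A] by (meson max.bounded_iff)
  define \<eta> where "\<eta> k = 1 / real (Suc k)" for k
  have \<eta>: "\<eta> \<longlonglongrightarrow> 0" unfolding \<eta>_def[abs_def] by (rule LIMSEQ_Suc[OF lim_1_over_n])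
  have rp: "relaxed_program C (\<eta> k)" for k
    by unfold_locales (auto simp: \<eta>_def conv inter)
  have up: "relaxed_program.opt C c (\<eta> k) A \<le> c \<bullet> x + \<eta> k * (x \<bullet> x)" for k
    using A x by (intro relaxed_program.opt_upper_bound[OF rp]) auto
  have low: "L + \<eta> k * ((U + 1) * (L - c \<bullet> x0) / r) \<le> relaxed_program.opt C c (\<eta> k) (insert w A)" for k
    by (rule relaxed_program.opt_lower_bound[OF rp _ _ r(1) _ U0])
       (use r U A L in auto)
  have "(\<lambda>k. L + \<eta> k * ((U + 1) * (L - c \<bullet> x0) / r) - (c \<bullet> x + \<eta> k * (x \<bullet> x))) \<longlonglongrightarrow> L + 0 * ((U + 1) * (L - c \<bullet> x0) / r) - (c \<bullet> x + 0 * (x \<bullet> x))"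
    by (intro tendsto_intros \<eta>)
  then have "\<forall>\<^sub>F k in sequentially. 0 < L + \<eta> k * ((U + 1) * (L - c \<bullet> x0) / r) - (c \<bullet> x + \<eta> k * (x \<bullet> x))"
    using less by (intro order_tendstoD(1)) auto
  then show ?thesis
    unfolding \<eta>_def[symmetric]
  proof eventually_elim
    case (elim k)
    then show ?case using up[of k] low[of k] by linarith
  qed
qed

text \<open>If the bound failed, the bad samples would have mass above the tail. Each of them lies
  eventually in the event \<open>W k\<close> that the relaxed problem is violated with probability
  at least \<delta>, so some \<open>W k\<close> would be too large for
  \<open>violation_tail\<close>. The gap \<open>L\<close> in \<open>improve\<close> is what survives
  the perturbation.\<close>

theorem scenario_tail:
  fixes C :: "'a \<Rightarrow> 'x::euclidean_space set" and sol :: "(nat \<Rightarrow> 'a) \<Rightarrow> 'x"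
  assumes P: "prob_space P" "space P = UNIV"
    and C_meas: "\<And>x. {\<xi> \<in> space P. x \<in> C \<xi>} \<in> sets P"
    and conv: "\<And>\<xi>. convex (C \<xi>)"
    and inter: "\<And>A. finite A \<Longrightarrow> A \<noteq> {} \<Longrightarrow> interior (\<Inter>\<xi>\<in>A. C \<xi>) \<noteq> {}"
    and sol: "\<And>s i. i < N \<Longrightarrow> sol s \<in> C (s i)"
    and improve: "\<And>s \<xi>. sol s \<notin> C \<xi> \<Longrightarrow>
        \<exists>L. c \<bullet> sol s < L \<and> (\<forall>y\<in>C \<xi>. (\<forall>i<N. y \<in> C (s i)) \<longrightarrow> L \<le> c \<bullet> y)"
    and V_meas: "(\<lambda>s. measure P {\<xi> \<in> space P. sol s \<notin> C \<xi>}) \<in> borel_measurable (Pi\<^sub>M {..<N} (\<lambda>_. P))"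
    and sol_cong: "\<And>s. sol (restrict s {..<N}) = sol s"
    and N: "DIM('x) \<le> N" and \<delta>: "0 \<le> \<delta>'" "\<delta>' < \<delta>" "\<delta> \<le> 1"
  shows "measure (Pi\<^sub>M {..<N} (\<lambda>_. P)) {s \<in> space (Pi\<^sub>M {..<N} (\<lambda>_. P)). \<delta> < measure P {\<xi> \<in> space P. sol s \<notin> C \<xi>}}
           \<le> binomial_tail N DIM('x) \<delta>'"
proof (rule ccontr)
  interpret P: prob_space P by fact
  interpret U: prob_space unit_uniform by (rule prob_space_unit_uniform)
  interpret PU: pair_prob_space P unit_uniform ..
  define M where "M = P \<Otimes>\<^sub>M unit_uniform"
  interpret M: prob_space M unfolding M_def by (rule PU.prob_space_axioms)
  let ?I = "{..<N}"
  let ?PP = "Pi\<^sub>M ?I (\<lambda>_. P)" and ?MM = "Pi\<^sub>M ?I (\<lambda>_. M)"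
  interpret MM: prob_space ?MM by (intro prob_space_PiM M.prob_space_axioms)
  define V where "V s = measure P {\<xi> \<in> space P. sol s \<notin> C \<xi>}" for s
  define \<eta> where "\<eta> k = 1 / real (Suc k)" for k
  let ?opt = "\<lambda>k. relaxed_program.opt C c (\<eta> k)"
  have rp: "relaxed_program C (\<eta> k)" for k
    by unfold_locales (auto simp: \<eta>_def conv inter)
  have rlp: "random_lp M (?opt k) DIM('x)" for k
    unfolding M_def by (rule relaxed_program.random_lp_opt[OF rp P C_meas])
  define Bad where "Bad = {z \<in> space ?MM. \<delta> < V (\<lambda>i. fst (z i))}"
  define W where "W k = {z \<in> space ?MM. \<delta> \<le> random_lp.violation M (?opt k) (z ` ?I)}" for k
  have W: "W k \<in> sets ?MM" for k
    unfolding W_def using random_lp.measurable_violation[OF rlp, of ?I k] by measurable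
  have fst_M: "fst \<in> measurable M P" unfolding M_def by measurable
  \<comment> \<open>Forgetting the relaxations turns samples from \<open>M\<close> into samples from
    \<open>P\<close>.\<close>
  have "distr ?MM ?PP (compose ?I fst) = Pi\<^sub>M ?I (\<lambda>i. distr M P fst)"
    by (intro distr_PiM_finite_prob_space' M.prob_space_axioms P fst_M) auto
  also have "distr M P fst = P" unfolding M_def by (rule U.distr_pair_fst)
  finally have distr: "distr ?MM ?PP (compose ?I fst) = ?PP" .
  have cm: "compose ?I fst \<in> measurable ?MM ?PP"
    unfolding compose_def using fst_M by (intro measurable_restrict) (auto intro: measurable_compose[OF measurable_component_singleton])
  have V_compose: "V (compose ?I fst z) = V (\<lambda>i. fst (z i))" for z :: "nat \<Rightarrow> 'a \<times> real"
  proof -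
    have "compose ?I fst z = restrict (\<lambda>i. fst (z i)) ?I" by (simp add: compose_def)
    then show ?thesis unfolding V_def by (simp add: sol_cong)
  qed
  have VS: "{s \<in> space ?PP. \<delta> < V s} \<in> sets ?PP"
    using V_meas unfolding V_def by measurable
  have "measure ?PP {s \<in> space ?PP. \<delta> < V s} = measure (distr ?MM ?PP (compose ?I fst)) {s \<in> space ?PP. \<delta> < V s}"
    by (simp add: distr)
  also have "\<dots> = measure ?MM (compose ?I fst -` {s \<in> space ?PP. \<delta> < V s} \<inter> space ?MM)"
    by (rule measure_distr[OF cm VS])
  also have "compose ?I fst -` {s \<in> space ?PP. \<delta> < V s} \<inter> space ?MM = Bad"
    unfolding Bad_def using measurable_space[OF cm] by (auto simp: V_compose)
  finally have PB: "measure ?PP {s \<in> space ?PP. \<delta> < V s} = measure ?MM Bad" .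
  have "\<forall>\<^sub>F k in sequentially. z \<in> W k" if z: "z \<in> Bad" for z
  proof -
    let ?s = "\<lambda>i. fst (z i)"
    let ?A = "z ` ?I"
    let ?B = "{w \<in> space M. sol ?s \<notin> C (fst w)}"
    let ?D = "{\<xi> \<in> space P. sol ?s \<notin> C \<xi>}"
    have zs: "z \<in> space ?MM" and zV: "\<delta> < V ?s" using z by (auto simp: Bad_def)
    have D: "?D \<in> sets P" using C_meas[of "sol ?s"] by (rule sets.sets_Collect_neg)
    have "V ?s = measure (distr M P fst) ?D" unfolding \<open>distr M P fst = P\<close> V_def ..
    also have "\<dots> = measure M (fst -` ?D \<inter> space M)" by (rule measure_distr[OF fst_M D])
    also have "fst -` ?D \<inter> space M = ?B" using P by auto
    finally have VB: "\<delta> < measure M ?B" using zV by simp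
    have "\<forall>\<^sub>F k in sequentially. \<delta> < measure M {w \<in> space M. ?opt k ?A < ?opt k (insert w ?A)}"
    \<comment> \<open>First limit, over the new constraint \<open>w\<close>: every violation of the
      original solution persists for small relaxations.\<close>
    proof (rule measure_liminf_greater[OF M.finite_measure_axioms _ _ VB])
      show "{w \<in> space M. ?opt k ?A < ?opt k (insert w ?A)} \<in> sets M" for k
        using random_lp.sets_violation[OF rlp _ zs] by auto
    next
      fix w assume w: "w \<in> ?B"
      then obtain L where L: "c \<bullet> sol ?s < L" "\<And>y. y \<in> C (fst w) \<Longrightarrow> (\<forall>i<N. y \<in> C (?s i)) \<Longrightarrow> L \<le> c \<bullet> y"
        using improve[of ?s "fst w"] by auto
      have "\<forall>\<^sub>F k in sequentially. ?opt k ?A < ?opt k (insert w ?A)"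
        unfolding \<eta>_def
        by (rule relaxed_opt_strict_eventually[OF conv inter _ _ _ L(1)]) (use sol[of _ ?s] L(2) in auto)
      then show "\<forall>\<^sub>F k in sequentially. w \<in> {w \<in> space M. ?opt k ?A < ?opt k (insert w ?A)}"
        using w by auto
    qed
    then show ?thesis
      by eventually_elim (use zs in \<open>auto simp: W_def random_lp.violation_def[OF rlp]\<close>)
  qed
  moreover assume "\<not> measure ?PP {s \<in> space ?PP. \<delta> < measure P {\<xi> \<in> space P. sol s \<notin> C \<xi>}} \<le> binomial_tail N DIM('x) \<delta>'"
  then have "binomial_tail N DIM('x) \<delta>' < measure ?MM Bad"
    unfolding PB[symmetric] V_def by simp
  \<comment> \<open>Second limit, over the sample \<open>z\<close>.\<close>
  ultimately have "\<forall>\<^sub>F k in sequentially. binomial_tail N DIM('x) \<delta>' < measure ?MM (W k)"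
    using W by (intro measure_liminf_greater[OF MM.finite_measure_axioms])
  then obtain k where "binomial_tail N DIM('x) \<delta>' < measure ?MM (W k)"
    using eventually_happens'[OF sequentially_bot] by blast
  moreover have "measure ?MM (W k) \<le> binomial_tail N DIM('x) \<delta>'"
    unfolding W_def using N \<delta> by (intro random_lp.violation_tail[OF rlp]) (auto simp: Suc_leI)
  ultimately show False by simp
qed

section \<open>Distributional robustness\<close>

lemma phi_conj_ge: "0 \<le> h \<Longrightarrow> ereal (t * h - \<phi> h) \<le> phi_conj \<phi> t"
  unfolding phi_conj_def by (rule SUP_upper2[of h]) (auto simp: phi_ext_def)

lemma phi_conj_ge_self: "\<phi> 1 = 0 \<Longrightarrow> ereal t \<le> phi_conj \<phi> t"
  using phi_conj_ge[of 1 t \<phi>] by simp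

lemma phi_conj_mono:
  assumes "s \<le> t"
  shows "phi_conj \<phi> s \<le> phi_conj \<phi> t"
  unfolding phi_conj_def
proof (rule SUP_mono)
  fix x :: real
  have "ereal (s * x) - phi_ext \<phi> x \<le> ereal (t * x) - phi_ext \<phi> x"
    using assms by (auto simp: phi_ext_def intro: mult_right_mono)
  then show "\<exists>y\<in>UNIV. ereal (s * x) - phi_ext \<phi> x \<le> ereal (t * y) - phi_ext \<phi> y"
    by blast
qed

text \<open>Fenchel's inequality applied pointwise to the likelihood ratio and to the step function
  \<open>z0 + z * indicator B\<close>.\<close>

lemma phi_div_weak_duality:
  assumes P: "prob_space P" "prob_space Q" "sets Q = sets P" "absolutely_continuous P Q"
    and div: "phi_div \<phi> P Q \<le> ennreal l" "0 \<le> l"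
    and B: "B \<in> sets P"
    and a: "phi_conj \<phi> z0 = ereal a" and b: "phi_conj \<phi> (z0 + z) = ereal b"
  shows "z0 + z * measure Q B - a - (b - a) * measure P B \<le> l"
proof -
  interpret P: prob_space P by fact
  interpret Q: prob_space Q by fact
  define h where "h x = enn2real (RN_deriv P Q x)" for x
  \<comment> \<open>The Fenchel minorant of \<open>\<phi> (h x)\<close>, with the conjugate value
    \<open>a\<close> off \<open>B\<close> and \<open>b\<close> on \<open>B\<close>. Its integral is
    the left-hand side of the claim.\<close>
  define r where "r x = z0 * (h x * 1) + z * (h x * indicator B x) - a - (b - a) * indicator B x" for x
  note RN = P.RN_deriv_integrable[OF Q.sigma_finite_measure_axioms P(4,3)]
    P.RN_deriv_integral[OF Q.sigma_finite_measure_axioms P(4,3)]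
  have BQ: "B \<in> sets Q" using B P(3) by simp
  have h1: "integrable P (\<lambda>x. h x * 1)" "(\<integral>x. h x * 1 \<partial>P) = 1"
    using RN[of "\<lambda>_. 1"] Q.prob_space unfolding h_def by auto
  have hB: "integrable P (\<lambda>x. h x * indicator B x)" "(\<integral>x. h x * indicator B x \<partial>P) = measure Q B"
    using RN[of "indicator B"] B BQ unfolding h_def by (auto simp: Q.emeasure_eq_measure)
  have iB: "integrable P (indicator B :: _ \<Rightarrow> real)"
    using B by (auto simp: P.emeasure_eq_measure)
  have r: "integrable P r"
    unfolding r_def[abs_def]
    by (intro Bochner_Integration.integrable_diff Bochner_Integration.integrable_add integrable_mult_right h1(1) hB(1) iB) auto
  have "(\<integral>x. r x \<partial>P) = z0 * (\<integral>x. h x * 1 \<partial>P) + z * (\<integral>x. h x * indicator B x \<partial>P) - a - (b - a) * measure P B"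
    unfolding r_def using h1(1) hB(1) iB B by (simp add: P.prob_space del: mult_1_right)
  then have "z0 + z * measure Q B - a - (b - a) * measure P B = (\<integral>x. r x \<partial>P)"
    unfolding h1 hB by simp
  \<comment> \<open>The negative part of \<open>r\<close> is dropped, since \<open>phi_div\<close>
    is a nonnegative integral.\<close>
  also have "\<dots> \<le> enn2real (\<integral>\<^sup>+x. ennreal (r x) \<partial>P)"
    unfolding real_lebesgue_integral_def[OF r] by simp
  also have "\<dots> \<le> enn2real (ennreal l)"
  proof (rule enn2real_mono)
    have "(\<integral>\<^sup>+x. ennreal (r x) \<partial>P) \<le> (\<integral>\<^sup>+x. ennreal (\<phi> (h x)) \<partial>P)"
    proof (intro nn_integral_mono ennreal_leI)
      fix x
      have "z0 * h x - \<phi> (h x) \<le> a" "(z0 + z) * h x - \<phi> (h x) \<le> b"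
        using phi_conj_ge[of "h x" z0 \<phi>] phi_conj_ge[of "h x" "z0 + z" \<phi>] a b by (auto simp: h_def)
      then show "r x \<le> \<phi> (h x)"
        by (auto simp: r_def indicator_def algebra_simps)
    qed
    also have "\<dots> \<le> ennreal l" using div(1) unfolding phi_div_def h_def .
    finally show "(\<integral>\<^sup>+x. ennreal (r x) \<partial>P) \<le> ennreal l" .
  qed simp
  finally show ?thesis using div by simp
qed

section \<open>Bounds for the adjusted tolerance\<close>

definition admissible :: "(real \<Rightarrow> real) \<Rightarrow> real \<Rightarrow> real \<Rightarrow> bool" where
  "admissible \<phi> z0 z \<longleftrightarrow> 0 < z \<and> m_lower \<phi> \<le> ereal (z0 + z) \<and> ereal (z0 + z) \<le> m_upper \<phi> \<and>
     phi_conj \<phi> (z0 + z) < \<infinity>"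

lemma eps_adjusted_alt:
  "eps_adjusted \<epsilon> l \<phi> =
     real_of_ereal (max (1 - Inf {eps_quotient \<epsilon> l \<phi> z0 z | z0 z. admissible \<phi> z0 z}) 0)"
  unfolding eps_adjusted_def admissible_def ..

lemma eps_adjusted_le:
  assumes "0 \<le> v" "\<And>z0 z. admissible \<phi> z0 z \<Longrightarrow> ereal (1 - v) \<le> eps_quotient \<epsilon> l \<phi> z0 z"
  shows "eps_adjusted \<epsilon> l \<phi> \<le> v"
proof -
  let ?S = "{eps_quotient \<epsilon> l \<phi> z0 z | z0 z. admissible \<phi> z0 z}"
  have "ereal (1 - v) \<le> Inf ?S" using assms by (auto intro!: Inf_greatest)
  then have "1 - Inf ?S \<le> ereal v"
    by (cases "Inf ?S") (auto simp: one_ereal_def)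
  then have "max (1 - Inf ?S) 0 \<le> ereal v" using assms by simp
  then show ?thesis
    unfolding eps_adjusted_alt using assms by (cases "max (1 - Inf ?S) 0") auto
qed

text \<open>The conjugate dominates the identity and is nondecreasing, so finiteness at
  \<open>z0 + z\<close> forces finite values at both points. A zero denominator falls under the
  infinite case.\<close>

lemma eps_quotient_cases:
  assumes "\<phi> 1 = 0" "admissible \<phi> z0 z"
  obtains (infinite) "eps_quotient \<epsilon> l \<phi> z0 z = \<infinity>"
    | (finite) a b where "phi_conj \<phi> z0 = ereal a" "phi_conj \<phi> (z0 + z) = ereal b" "a < b" "z0 + z \<le> b"
        "eps_quotient \<epsilon> l \<phi> z0 z = ereal ((b - z0 - \<epsilon> * z + l) / (b - a))"
proof -
  have z: "0 < z" "phi_conj \<phi> (z0 + z) < \<infinity>" using assms by (auto simp: admissible_def)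
  have ge: "ereal (z0 + z) \<le> phi_conj \<phi> (z0 + z)" "ereal z0 \<le> phi_conj \<phi> z0"
    by (intro phi_conj_ge_self assms)+
  have mono: "phi_conj \<phi> z0 \<le> phi_conj \<phi> (z0 + z)" using z by (intro phi_conj_mono) simp
  obtain b where b: "phi_conj \<phi> (z0 + z) = ereal b" using z ge by (cases "phi_conj \<phi> (z0 + z)") auto
  obtain a where a: "phi_conj \<phi> z0 = ereal a" using b mono ge by (cases "phi_conj \<phi> z0") auto
  show ?thesis
  proof (cases "a = b")
    case True
    then show ?thesis using infinite a b by (simp add: eps_quotient_def zero_ereal_def)
  next
    case False
    then have "a < b" using mono a b by simp
    moreover have "eps_quotient \<epsilon> l \<phi> z0 z = ereal ((b - z0 - \<epsilon> * z + l) / (b - a))"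
      using False by (simp add: eps_quotient_def a b zero_ereal_def)
    ultimately show ?thesis using finite a b ge by simp
  qed
qed

text \<open>All quotients are nonnegative because the conjugate at \<open>z0 + z\<close> is at least
  \<open>z0 + z\<close> and \<open>\<epsilon> * z \<le> z\<close>. So \<delta> can serve as a
  probability level.\<close>

lemma eps_adjusted_le_1:
  assumes "\<phi> 1 = 0" "\<epsilon> \<le> 1" "0 \<le> l"
  shows "eps_adjusted \<epsilon> l \<phi> \<le> 1"
proof (rule eps_adjusted_le)
  fix z0 z assume adm: "admissible \<phi> z0 z"
  then have ez: "\<epsilon> * z \<le> z" using assms by (simp add: admissible_def)
  show "ereal (1 - 1) \<le> eps_quotient \<epsilon> l \<phi> z0 z"
  proof (rule eps_quotient_cases[OF assms(1) adm, of \<epsilon> l])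
    fix a b
    assume finite: "phi_conj \<phi> z0 = ereal a" "phi_conj \<phi> (z0 + z) = ereal b" "a < b" "z0 + z \<le> b"
      "eps_quotient \<epsilon> l \<phi> z0 z = ereal ((b - z0 - \<epsilon> * z + l) / (b - a))"
    have "0 \<le> (b - z0 - \<epsilon> * z + l) / (b - a)"
      using finite(3,4) ez assms by (intro divide_nonneg_pos) auto
    then show "ereal (1 - 1) \<le> eps_quotient \<epsilon> l \<phi> z0 z" by (simp add: finite(5))
  qed simp
qed simp

text \<open>Solved for \<open>measure P B\<close>, weak duality bounds every quotient below by
  \<open>1 - measure P B\<close>. This transfers a violation under the true law to the sampling
  law.\<close>

lemma eps_adjusted_le_measure:
  assumes P: "prob_space P" "prob_space Q" "sets Q = sets P" "absolutely_continuous P Q"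
    and div: "phi_div \<phi> P Q \<le> ennreal l" "0 \<le> l" and \<phi>: "\<phi> 1 = 0"
    and B: "B \<in> sets P" "\<epsilon> < measure Q B"
  shows "eps_adjusted \<epsilon> l \<phi> \<le> measure P B"
proof (rule eps_adjusted_le)
  fix z0 z assume adm: "admissible \<phi> z0 z"
  show "ereal (1 - measure P B) \<le> eps_quotient \<epsilon> l \<phi> z0 z"
  proof (rule eps_quotient_cases[OF \<phi> adm, of \<epsilon> l])
    fix a b
    assume finite: "phi_conj \<phi> z0 = ereal a" "phi_conj \<phi> (z0 + z) = ereal b" "a < b" "z0 + z \<le> b"
      "eps_quotient \<epsilon> l \<phi> z0 z = ereal ((b - z0 - \<epsilon> * z + l) / (b - a))"
    have "\<epsilon> * z \<le> z * measure Q B" using B adm by (simp add: admissible_def mult.commute)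
    with phi_div_weak_duality[OF P div B(1) finite(1,2)]
    have "(1 - measure P B) * (b - a) \<le> b - z0 - \<epsilon> * z + l" by (simp add: algebra_simps)
    then show "ereal (1 - measure P B) \<le> eps_quotient \<epsilon> l \<phi> z0 z" using finite(3) by (simp add: finite(5) le_divide_eq)
  qed simp
qed simp

text \<open>The minimum at 1 gives a vanishing first derivative there; a negative second derivative
  would then push \<phi> below 0 to the right of 1. This is needed for a nonnegative radius.\<close>

lemma phi_generator_second_deriv_nonneg:
  assumes "phi_generator \<phi>"
  shows "0 \<le> deriv (deriv \<phi>) 1"
proof (rule ccontr)
  assume neg: "\<not> 0 \<le> deriv (deriv \<phi>) 1"
  have \<phi>: "\<And>x. 0 \<le> x \<Longrightarrow> 0 \<le> \<phi> x" "\<phi> 1 = 0"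
    and d1: "\<And>x. 0 < x \<Longrightarrow> (\<phi> has_real_derivative deriv \<phi> x) (at x)"
    and d2: "\<And>x. 0 < x \<Longrightarrow> (deriv \<phi> has_real_derivative deriv (deriv \<phi>) x) (at x)"
    using assms by (auto simp: phi_generator_def DERIV_deriv_iff_real_differentiable)
  have "deriv \<phi> 1 = 0"
    by (rule DERIV_local_min[OF d1[of 1], where d = 1]) (use \<phi> in \<open>auto simp: abs_less_iff\<close>)
  moreover obtain s where s: "0 < s" "\<And>h. 0 < h \<Longrightarrow> h < s \<Longrightarrow> deriv \<phi> (1 + h) < deriv \<phi> 1"
    using DERIV_neg_dec_right[OF d2[of 1]] neg by auto
  ultimately have less: "deriv \<phi> x < 0" if "1 < x" "x < 1 + s" for x
    using s(2)[of "x - 1"] that by auto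
  have "\<phi> (1 + s / 2) < \<phi> 1"
  proof (rule DERIV_neg_imp_decreasing_open[where a = 1 and f = \<phi>])
    show "\<exists>y. (\<phi> has_real_derivative y) (at x) \<and> y < 0" if "1 < x" "x < 1 + s / 2" for x
      using d1[of x] less[of x] that s(1) by auto
    show "continuous_on {1..1 + s / 2} \<phi>"
      by (intro continuous_at_imp_continuous_on ballI DERIV_isCont[OF d1]) auto
  qed (use s in auto)
  then show False using \<phi>(1)[of "1 + s / 2"] \<phi>(2) s(1) by simp
qed

text \<open>A sum of squares has no mass on the negative half-line, so no negative point reaches the
  level \<open>q\<close>. That some point reaches it keeps the real infimum meaningful.\<close>

lemma quantile_chi_square_nonneg:
  assumes "0 < q" "q < 1"
  shows "0 \<le> quantile (chi_square D) q"
proof -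
  let ?N = "density lborel (\<lambda>x. ennreal (std_normal_density x))"
  let ?PN = "\<Pi>\<^sub>M i\<in>{..<D}. ?N"
  have "prob_space ?PN" by (intro prob_space_PiM prob_space_normal_density) simp
  then interpret PN: prob_space ?PN .
  have m: "(\<lambda>x. \<Sum>i<D. (x i)\<^sup>2) \<in> borel_measurable ?PN" by measurable
  interpret X: real_distribution "chi_square D"
    unfolding real_distribution_def real_distribution_axioms_def chi_square_def
    using PN.prob_space_distr[OF m] by simp
  have "\<forall>\<^sub>F x in at_top. q < cdf (chi_square D) x"
    using X.cdf_lim_at_top_prob assms by (intro order_tendstoD(1))
  then obtain x where "q < cdf (chi_square D) x"
    using eventually_happens by fastforce
  then have ne: "{x. q \<le> cdf (chi_square D) x} \<noteq> {}" by (auto intro: less_imp_le)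
  show ?thesis
    unfolding quantile_def
  proof (rule cInf_greatest[OF ne])
    fix x assume x: "x \<in> {x. q \<le> cdf (chi_square D) x}"
    show "0 \<le> x"
    proof (rule ccontr)
      assume x0: "\<not> 0 \<le> x"
      have "\<not> (\<Sum>i<D. (y i)\<^sup>2) \<le> x" for y :: "nat \<Rightarrow> real"
        using x0 sum_nonneg[of "{..<D}" "\<lambda>i. (y i)\<^sup>2"] by auto
      then have "(\<lambda>y. \<Sum>i<D. (y i)\<^sup>2) -` {..x} \<inter> space ?PN = {}" by auto
      then have "cdf (chi_square D) x = 0"
        unfolding cdf_def chi_square_def by (subst measure_distr[OF m]) auto
      then show False using x assms by simp
    qed
  qed
qed

lemma div_radius_nonneg:
  assumes "phi_generator \<phi>" "0 < \<alpha>" "\<alpha> < 1"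
  shows "0 \<le> div_radius \<phi> \<alpha> D n"
  unfolding div_radius_def
  using phi_generator_second_deriv_nonneg[OF assms(1)] quantile_chi_square_nonneg[of "1 - \<alpha>" D] assms
  by (intro divide_nonneg_nonneg mult_nonneg_nonneg) auto

section \<open>The sample size\<close>

text \<open>After a shift by \<open>i\<close>, the coefficient is at most
  \<open>(n + i) ^ i\<close>, and geometric decay beats this power of \<open>n\<close>.\<close>

lemma binomial_times_power_tendsto_0:
  fixes x :: real
  assumes "0 \<le> x" "x < 1"
  shows "(\<lambda>n. real (n choose i) * x ^ (n - i)) \<longlonglongrightarrow> 0"
proof (rule LIMSEQ_offset[where k = i], cases "i = 0")
  case True
  then show "(\<lambda>n. real (n + i choose i) * x ^ (n + i - i)) \<longlonglongrightarrow> 0"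
    using assms by (simp add: LIMSEQ_realpow_zero)
next
  case False
  \<comment> \<open>With \<open>y ^ i = x\<close> the bound becomes the \<open>i\<close>-th power of
    \<open>(n + i) * y ^ n\<close>, a linear times a geometric term.\<close>
  define y where "y = root i x"
  have y: "0 \<le> y" "y < 1" "y ^ i = x"
    using assms False by (auto simp: y_def real_root_lt_1_iff real_root_pow_pos2)
  have "(\<lambda>n. real n * y ^ n + real i * y ^ n) \<longlonglongrightarrow> 0 + real i * 0"
    using y by (intro tendsto_add tendsto_mult_left powser_times_n_limit_0 LIMSEQ_realpow_zero) auto
  then have "(\<lambda>n. (real n * y ^ n + real i * y ^ n) ^ i) \<longlonglongrightarrow> (0 + real i * 0) ^ i"
    by (intro tendsto_power)
  moreover have "(0 + real i * 0) ^ i = 0" using False by simp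
  ultimately have lim: "(\<lambda>n. (real n * y ^ n + real i * y ^ n) ^ i) \<longlonglongrightarrow> 0" by (simp only:)
  have "real (n + i choose i) * x ^ n \<le> (real n * y ^ n + real i * y ^ n) ^ i" for n
  proof -
    have "real (n + i choose i) \<le> real ((n + i) ^ i)"
      using binomial_le_pow[of i "n + i"] by (intro of_nat_mono) simp
    then have "real (n + i choose i) * x ^ n \<le> real (n + i) ^ i * x ^ n"
      using assms by (intro mult_right_mono) auto
    also have "real (n + i) ^ i * x ^ n = real (n + i) ^ i * (y ^ n) ^ i" using y(3) by (metis power_mult mult.commute)
    also have "\<dots> = (real n * y ^ n + real i * y ^ n) ^ i"
      by (simp add: power_mult_distrib[symmetric] algebra_simps)
    finally show ?thesis .
  qed
  then show "(\<lambda>n. real (n + i choose i) * x ^ (n + i - i)) \<longlonglongrightarrow> 0"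
    using assms by (intro tendsto_sandwich[OF _ _ tendsto_const lim]) (auto intro!: always_eventually)
qed

lemma binomial_tail_tendsto_0:
  assumes "0 < \<delta>" "\<delta> \<le> 1"
  shows "(\<lambda>n. binomial_tail n d \<delta>) \<longlonglongrightarrow> 0"
proof -
  have "(\<lambda>n. \<Sum>i<d. \<delta> ^ i * (real (n choose i) * (1 - \<delta>) ^ (n - i))) \<longlonglongrightarrow> (\<Sum>i<d. \<delta> ^ i * 0)"
    using assms by (intro tendsto_sum tendsto_mult_left binomial_times_power_tendsto_0) auto
  then show ?thesis unfolding binomial_tail_def by (simp add: mult_ac)
qed

text \<open>The tail tends to 0, so the minimum in \<open>N_exact\<close> is taken over a nonempty
  set.\<close>

lemma binomial_tail_N_exact_le:
  assumes "0 < \<delta>" "\<delta> \<le> 1" "0 < \<beta>"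
  shows "binomial_tail (N_exact \<delta> \<beta> d) d \<delta> \<le> \<beta>"
proof -
  obtain n where "binomial_tail n d \<delta> < \<beta>"
    using order_tendstoD(2)[OF binomial_tail_tendsto_0[OF assms(1,2)] assms(3)]
    by (metis eventually_happens' sequentially_bot)
  then show ?thesis
    using LeastI[of "\<lambda>n. binomial_tail n d \<delta> \<le> \<beta>" n]
    unfolding N_exact_def binomial_tail_def by simp
qed

lemma binomial_tail_eq_1:
  assumes "N < d"
  shows "binomial_tail N d \<delta> = 1"
proof -
  have "binomial_tail N d \<delta> = (\<Sum>i\<le>N. real (N choose i) * \<delta> ^ i * (1 - \<delta>) ^ (N - i))"
    unfolding binomial_tail_def using assms by (intro sum.mono_neutral_right) auto
  also have "\<dots> = (\<delta> + (1 - \<delta>)) ^ N" by (rule binomial_ring[symmetric])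
  finally show ?thesis by simp
qed

text \<open>With fewer than \<open>d\<close> trials the tail is the full binomial sum 1, which
  exceeds \<beta>.\<close>

lemma dim_le_N_exact:
  assumes "0 < \<delta>" "\<delta> \<le> 1" "0 < \<beta>" "\<beta> < 1"
  shows "d \<le> N_exact \<delta> \<beta> d"
  using binomial_tail_N_exact_le[OF assms(1-3), of d] binomial_tail_eq_1[of "N_exact \<delta> \<beta> d" d \<delta>] assms
  by (cases "d \<le> N_exact \<delta> \<beta> d") auto

lemma continuous_binomial_tail: "continuous_on S (binomial_tail N d)"
  unfolding binomial_tail_def[abs_def] by (intro continuous_intros)

section \<open>The joint law of data and Monte Carlo samples\<close>

lemma prob_space_iid: "prob_space Q \<Longrightarrow> prob_space (iid n Q)"
  unfolding iid_def by (intro prob_space_PiM)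

lemma sets_iid: "sets Q = sets borel \<Longrightarrow> sets (iid n Q) = sets (iid n borel)"
  unfolding iid_def by (intro sets_PiM_cong) auto

text \<open>It suffices to test on boxes, an intersection-stable generator, where the probability is
  a finite product of measurable functions.\<close>

lemma measurable_iid_kernel:
  assumes "K \<in> measurable M (prob_algebra borel)"
  shows "(\<lambda>x. iid n (K x)) \<in> measurable M (prob_algebra (iid n borel))"
proof (rule measurable_prob_algebra_generated)
  let ?G = "prod_algebra {..<n} (\<lambda>_. borel :: 'b measure)"
  have K: "prob_space (K x)" "sets (K x) = sets borel" if "x \<in> space M" for x
    using measurable_space[OF assms that] by (auto simp: space_prob_algebra)
  show "sets (iid n (borel :: 'b measure)) = sigma_sets (\<Pi>\<^sub>E i\<in>{..<n}. space borel) ?G"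
    unfolding iid_def by (rule sets_PiM)
  show "Int_stable ?G" by (rule Int_stable_prod_algebra)
  show "?G \<subseteq> Pow (\<Pi>\<^sub>E i\<in>{..<n}. space borel)" by (rule prod_algebra_sets_into_space)
  show "prob_space (iid n (K x))" "sets (iid n (K x)) = sets (iid n borel)" if "x \<in> space M" for x
    by (rule prob_space_iid[OF K(1)[OF that]], rule sets_iid[OF K(2)[OF that]])
  fix A assume "A \<in> ?G"
  then obtain E where E: "A = Pi\<^sub>E {..<n} E" "\<And>i. i < n \<Longrightarrow> E i \<in> sets borel"
    by (auto elim!: prod_algebraE_all simp: Pi_iff)
  have "emeasure (iid n (K x)) A = (\<Prod>i<n. emeasure (K x) (E i))" if x: "x \<in> space M" for x
  proof -
    interpret K: prob_space "K x" using K[OF x] by simp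
    interpret product_sigma_finite "\<lambda>_::nat. K x" by unfold_locales
    show ?thesis unfolding iid_def E(1) using E(2) K[OF x] by (intro emeasure_PiM) auto
  qed
  moreover have "(\<lambda>x. \<Prod>i<n. emeasure (K x) (E i)) \<in> borel_measurable M"
    using E(2) by (intro borel_measurable_prod_ennreal measurable_emeasure_kernel[OF measurable_prob_algebraD[OF assms]]) auto
  ultimately show "(\<lambda>x. emeasure (iid n (K x)) A) \<in> borel_measurable M"
    by (simp cong: measurable_cong)
qed

text \<open>The event concerns the Monte Carlo samples only. Its conditional probability given the
  data is integrated, and data outside \<open>A\<close> are bounded below by 0.\<close>

lemma data_mc_law_lower_bound:
  assumes Q: "prob_space Q" "sets Q = sets borel"
    and K: "K \<in> measurable (iid n borel) (prob_algebra borel)"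
    and A: "A \<in> sets (iid n Q)"
    and G: "{s \<in> space (iid N borel). G s} \<in> sets (iid N borel)"
    and bound: "\<And>\<xi>. \<xi> \<in> A \<Longrightarrow> 1 - \<beta> \<le> measure (iid N (K \<xi>)) {s \<in> space (iid N borel). G s}"
    and \<beta>: "\<beta> \<le> 1"
  shows "(1 - \<beta>) * measure (iid n Q) A
    \<le> measure (data_mc_law n N Q K) {w \<in> space (data_mc_law n N Q K). G (snd w)}"
proof -
  let ?R = "iid n borel \<Otimes>\<^sub>M iid N borel :: ((nat \<Rightarrow> 'a) \<times> (nat \<Rightarrow> 'a)) measure"
  let ?K = "\<lambda>\<xi>. distr (iid N (K \<xi>)) ?R (\<lambda>s. (\<xi>, s))"
  let ?L = "data_mc_law n N Q K"
  define S where "S = {s \<in> space (iid N borel). G s}"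
  interpret Q: prob_space "iid n Q" using Q by (intro prob_space_iid)
  have spQ: "space (iid n Q) = space (iid n borel)"
    using sets_iid[OF Q(2)] by (rule sets_eq_imp_space_eq)
  have Qin: "iid n Q \<in> space (prob_algebra (iid n borel))"
    using prob_space_iid[OF Q(1)] sets_iid[OF Q(2)] by (simp add: space_prob_algebra)
  have kern: "?K \<in> measurable (iid n borel) (prob_algebra ?R)"
    by (rule measurable_distr_prob_space2[OF measurable_iid_kernel[OF K]]) simp
  have L: "?L = iid n Q \<bind> ?K" unfolding data_mc_law_def ..
  interpret L: prob_space ?L unfolding L by (rule prob_space_bind'[OF Qin kern])
  have setsL: "sets ?L = sets ?R" unfolding L by (rule sets_bind'[OF Qin kern])
  have event: "{w \<in> space ?L. G (snd w)} = space (iid n borel) \<times> S"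
    unfolding sets_eq_imp_space_eq[OF setsL] S_def by (auto simp: space_pair_measure)
  have E: "space (iid n borel) \<times> S \<in> sets ?R"
    using G unfolding S_def by auto
  have inner: "emeasure (?K \<xi>) (space (iid n borel) \<times> S) = emeasure (iid N (K \<xi>)) S"
    if \<xi>: "\<xi> \<in> space (iid n borel)" for \<xi>
  proof -
    have "sets (iid N (K \<xi>)) = sets (iid N borel)"
      using measurable_space[OF K \<xi>] by (intro sets_iid) (simp add: space_prob_algebra)
    then have m: "(\<lambda>s. (\<xi>, s)) \<in> measurable (iid N (K \<xi>)) ?R" and sp: "space (iid N (K \<xi>)) = space (iid N borel)"
      using measurable_Pair1'[OF \<xi>, of "iid N borel"] sets_eq_imp_space_eq[of "iid N (K \<xi>)" "iid N borel"]
      by (simp_all cong: measurable_cong_sets)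
    show ?thesis
      by (subst emeasure_distr[OF m E], rule arg_cong[where f = "emeasure _"])
         (use \<xi> in \<open>auto simp: sp S_def\<close>)
  qed
  have "ennreal ((1 - \<beta>) * measure (iid n Q) A) = ennreal (1 - \<beta>) * emeasure (iid n Q) A"
    using \<beta> by (simp add: ennreal_mult Q.emeasure_eq_measure)
  also have "\<dots> = (\<integral>\<^sup>+\<xi>. ennreal (1 - \<beta>) * indicator A \<xi> \<partial>iid n Q)"
    by (rule nn_integral_cmult_indicator[OF A, symmetric])
  also have "\<dots> \<le> (\<integral>\<^sup>+\<xi>. emeasure (?K \<xi>) (space (iid n borel) \<times> S) \<partial>iid n Q)"
  proof (rule nn_integral_mono)
    fix \<xi> assume \<xi>: "\<xi> \<in> space (iid n Q)"
    have "prob_space (iid N (K \<xi>))"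
      using measurable_space[OF K] \<xi> spQ by (intro prob_space_iid) (auto simp: space_prob_algebra)
    then interpret IK: prob_space "iid N (K \<xi>)" .
    have "ennreal (1 - \<beta>) * indicator A \<xi> \<le> emeasure (iid N (K \<xi>)) S"
      using bound[of \<xi>] unfolding S_def[symmetric]
      by (auto simp: IK.emeasure_eq_measure indicator_def intro: ennreal_leI)
    then show "ennreal (1 - \<beta>) * indicator A \<xi> \<le> emeasure (?K \<xi>) (space (iid n borel) \<times> S)"
      using inner[of \<xi>] \<xi> spQ by simp
  qed
  also have "\<dots> = emeasure ?L {w \<in> space ?L. G (snd w)}"
    unfolding event unfolding L by (rule emeasure_bind_prob_algebra[OF Qin kern E, symmetric])
  finally show ?thesis
    unfolding L.emeasure_eq_measure by (simp add: ennreal_le_iff)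
qed

section \<open>The scenario bound for the sampled problem\<close>

lemma measurable_satisfaction:
  fixes Xc :: "'a::second_countable_topology \<Rightarrow> 'x::second_countable_topology set"
  assumes Q: "prob_space Q" "sets Q = sets borel"
    and Xc: "{(x, \<xi>). x \<in> Xc \<xi>} \<in> sets (borel \<Otimes>\<^sub>M borel)"
  shows "(\<lambda>x. measure Q {\<xi> \<in> space Q. x \<in> Xc \<xi>}) \<in> borel_measurable borel"
    and "{\<xi> \<in> space Q. x \<in> Xc \<xi>} \<in> sets Q"
proof -
  interpret Q: prob_space Q by fact
  have sp: "space Q = UNIV" using sets_eq_imp_space_eq[OF Q(2)] by simp
  have sets_eq: "sets (borel \<Otimes>\<^sub>M Q) = sets (borel \<Otimes>\<^sub>M borel)"
    using Q(2) by (intro sets_pair_measure_cong) auto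
  have eq: "{z \<in> space (borel \<Otimes>\<^sub>M Q). snd z \<in> {\<xi> \<in> space Q. fst z \<in> Xc \<xi>}} = {(x, \<xi>). x \<in> Xc \<xi>}"
    by (auto simp: space_pair_measure sp)
  have "(\<lambda>x. emeasure Q {\<xi> \<in> space Q. x \<in> Xc \<xi>}) \<in> borel_measurable borel"
    by (rule Q.measurable_emeasure) (simp, simp only: eq sets_eq Xc)
  then show "(\<lambda>x. measure Q {\<xi> \<in> space Q. x \<in> Xc \<xi>}) \<in> borel_measurable borel"
    unfolding measure_def by measurable
  have "{\<xi> \<in> space Q. x \<in> Xc \<xi>} = Pair x -` {(x, \<xi>). x \<in> Xc \<xi>}" by (auto simp: sp)
  also have "\<dots> \<in> sets Q" using sets_Pair1[OF Xc, of x] Q(2) by simp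
  finally show "{\<xi> \<in> space Q. x \<in> Xc \<xi>} \<in> sets Q" .
qed

locale sampled_problem =
  fixes X :: "'x::euclidean_space set" and Xc :: "'a::second_countable_topology \<Rightarrow> 'x set" and c :: 'x
  assumes Xc_sub: "\<And>\<xi>. Xc \<xi> \<subseteq> X"
    and Xc_convex: "\<And>\<xi>. convex (Xc \<xi>)"
    and sampled_interior:
      "\<And>m s. 1 \<le> m \<Longrightarrow> interior (sampled_region X Xc m s) \<noteq> {}"
    and sampled_unique:
      "\<And>m s. 1 \<le> m \<Longrightarrow> \<exists>!x. is_arg_min (\<lambda>x. c \<bullet> x) (\<lambda>x. x \<in> sampled_region X Xc m s) x"
    and Xc_measurable: "{(x, \<xi>). x \<in> Xc \<xi>} \<in> sets (borel \<Otimes>\<^sub>M borel)"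
    and solution_measurable:
      "\<And>m. 1 \<le> m \<Longrightarrow> sampled_solution c X Xc m \<in> measurable (iid m borel) borel"
begin

abbreviation sol :: "nat \<Rightarrow> (nat \<Rightarrow> 'a) \<Rightarrow> 'x" where
  "sol \<equiv> sampled_solution c X Xc"

lemma is_arg_min_sol:
  assumes "1 \<le> m"
  shows "is_arg_min (\<lambda>x. c \<bullet> x) (\<lambda>x. x \<in> sampled_region X Xc m s) (sol m s)"
  unfolding sampled_solution_def arg_min_def
  using sampled_unique[OF assms, of s] by (metis someI_ex)

lemma sol_in_region: "1 \<le> m \<Longrightarrow> sol m s \<in> sampled_region X Xc m s"
  and sol_minimal: "1 \<le> m \<Longrightarrow> y \<in> sampled_region X Xc m s \<Longrightarrow> c \<bullet> sol m s \<le> c \<bullet> y"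
  using is_arg_min_sol[of m s] by (auto simp: is_arg_min_def not_less)

lemma sol_strictly_minimal:
  assumes "1 \<le> m" "y \<in> sampled_region X Xc m s" "y \<noteq> sol m s"
  shows "c \<bullet> sol m s < c \<bullet> y"
proof (rule ccontr)
  assume "\<not> c \<bullet> sol m s < c \<bullet> y"
  then have "is_arg_min (\<lambda>x. c \<bullet> x) (\<lambda>x. x \<in> sampled_region X Xc m s) y"
    using sol_minimal[OF assms(1)] assms(2) by (fastforce simp: is_arg_min_def)
  then show False using sampled_unique[OF assms(1), of s] is_arg_min_sol[OF assms(1), of s] assms(3) by auto
qed

lemma sol_cong: "sol m (restrict s {..<m}) = sol m s"
  unfolding sampled_solution_def sampled_region_def by simp

text \<open>An enumeration of \<open>A\<close> is a sample whose region lies in the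
  intersection.\<close>

lemma interior_finite_Inter:
  assumes "finite A" "A \<noteq> {}"
  shows "interior (\<Inter>\<xi>\<in>A. Xc \<xi>) \<noteq> {}"
proof -
  obtain s where s: "A = s ` {i. i < card A}"
    using assms ex_bij_betw_nat_finite[of A] by (auto simp: bij_betw_def atLeast0LessThan lessThan_def)
  have "1 \<le> card A" using assms by (simp add: Suc_le_eq card_gt_0_iff)
  moreover have "sampled_region X Xc (card A) s \<subseteq> (\<Inter>\<xi>\<in>A. Xc \<xi>)"
    by (subst (2) s) (auto simp: sampled_region_def)
  ultimately show ?thesis
    using sampled_interior[of "card A" s] interior_mono by blast
qed

text \<open>The optimum after appending \<xi> as an additional sample is feasible for the original
  sample but differs from its solution, so by uniqueness it is strictly worse. Its value serves as
  \<open>L\<close>.\<close>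

lemma violation_forces_increase:
  assumes m: "1 \<le> m" and "sol m s \<notin> Xc \<xi>"
  shows "\<exists>L. c \<bullet> sol m s < L \<and> (\<forall>y\<in>Xc \<xi>. (\<forall>i<m. y \<in> Xc (s i)) \<longrightarrow> L \<le> c \<bullet> y)"
proof -
  let ?s = "s(m := \<xi>)"
  have region: "y \<in> sampled_region X Xc (Suc m) ?s \<longleftrightarrow> y \<in> sampled_region X Xc m s \<and> y \<in> Xc \<xi>" for y
    unfolding sampled_region_def by (auto simp: less_Suc_eq)
  have "sol (Suc m) ?s \<in> sampled_region X Xc m s" "sol (Suc m) ?s \<noteq> sol m s"
    using sol_in_region[of "Suc m" ?s] region[of "sol (Suc m) ?s"] assms(2) by auto
  then have "c \<bullet> sol m s < c \<bullet> sol (Suc m) ?s" by (intro sol_strictly_minimal m)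
  moreover have "c \<bullet> sol (Suc m) ?s \<le> c \<bullet> y" if "y \<in> Xc \<xi>" "\<forall>i<m. y \<in> Xc (s i)" for y
    using that Xc_sub by (intro sol_minimal) (auto simp: sampled_region_def less_Suc_eq)
  ultimately show ?thesis by blast
qed

lemma measurable_satisfaction_sol:
  assumes "prob_space Q" "sets Q = sets borel" "1 \<le> m"
  shows "(\<lambda>s. measure Q {\<xi> \<in> space Q. sol m s \<in> Xc \<xi>}) \<in> borel_measurable (iid m borel)"
  using measurable_compose[OF solution_measurable[OF assms(3)] measurable_satisfaction(1)[OF assms(1,2) Xc_measurable]] .

lemma prob_violation:
  assumes "prob_space Q" "sets Q = sets borel"
  shows "measure Q {\<xi> \<in> space Q. x \<notin> Xc \<xi>} = 1 - measure Q {\<xi> \<in> space Q. x \<in> Xc \<xi>}"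
proof -
  interpret prob_space Q by fact
  show ?thesis using measurable_satisfaction(2)[OF assms Xc_measurable, of x] by (rule prob_neg)
qed

lemma scenario_bound:
  assumes Q: "prob_space Q" "sets Q = sets borel"
    and \<delta>: "0 < \<delta>" "\<delta> \<le> 1" and \<beta>: "0 < \<beta>" "\<beta> < 1"
    and N: "N = N_exact \<delta> \<beta> DIM('x)"
  shows "measure (iid N Q) {s \<in> space (iid N Q). \<delta> \<le> measure Q {\<xi> \<in> space Q. sol N s \<notin> Xc \<xi>}} \<le> \<beta>"
proof -
  interpret Q: prob_space Q by fact
  interpret I: prob_space "iid N Q" using Q by (intro prob_space_iid)
  have sp: "space Q = UNIV" using sets_eq_imp_space_eq[OF Q(2)] by simp
  have DN: "DIM('x) \<le> N" unfolding N by (rule dim_le_N_exact[OF \<delta> \<beta>])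
  then have N1: "1 \<le> N" using DIM_positive[where 'a = 'x] by linarith
  define V where "V s = measure Q {\<xi> \<in> space Q. sol N s \<notin> Xc \<xi>}" for s
  have Vm: "V \<in> borel_measurable (iid N Q)"
    unfolding V_def[abs_def] prob_violation[OF Q]
    using measurable_satisfaction_sol[OF Q N1] sets_iid[OF Q(2), of N] measurable_cong_sets by fastforce
  have le: "measure (iid N Q) {s \<in> space (iid N Q). \<delta> \<le> V s} \<le> binomial_tail N DIM('x) \<delta>1"
    if \<delta>1: "0 \<le> \<delta>1" "\<delta>1 < \<delta>" for \<delta>1
  proof -
    \<comment> \<open>\<open>scenario_tail\<close> bounds the event of exceeding \<delta>2 by the
      tail at a strictly smaller level.\<close>
    obtain \<delta>2 where \<delta>2: "\<delta>1 < \<delta>2" "\<delta>2 < \<delta>" using dense \<delta>1 by blast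
    have "{s \<in> space (iid N Q). \<delta>2 < V s} \<in> sets (iid N Q)" using Vm by measurable
    then have "measure (iid N Q) {s \<in> space (iid N Q). \<delta> \<le> V s} \<le> measure (iid N Q) {s \<in> space (iid N Q). \<delta>2 < V s}"
      using \<delta>2 by (intro I.finite_measure_mono) auto
    also have "\<dots> \<le> binomial_tail N DIM('x) \<delta>1"
      unfolding iid_def V_def
    proof (rule scenario_tail[OF Q(1) sp, where c = c])
      show "{\<xi> \<in> space Q. x \<in> Xc \<xi>} \<in> sets Q" for x
        by (rule measurable_satisfaction(2)[OF Q Xc_measurable])
      show "(\<lambda>s. measure Q {\<xi> \<in> space Q. sol N s \<notin> Xc \<xi>}) \<in> borel_measurable (Pi\<^sub>M {..<N} (\<lambda>_. Q))"
        using Vm unfolding V_def[abs_def] iid_def .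
      show "sol N s \<in> Xc (s i)" if "i < N" for i s
        using sol_in_region[OF N1, of s] that by (simp add: sampled_region_def)
    qed (use DN N1 \<delta> \<delta>1 \<delta>2 Xc_convex interior_finite_Inter violation_forces_increase sol_cong in auto)
    finally show ?thesis .
  qed
  \<comment> \<open>Both losses vanish as the level increases to \<delta>, since the tail is
    continuous.\<close>
  have "((\<lambda>t. binomial_tail N DIM('x) t) \<longlongrightarrow> binomial_tail N DIM('x) \<delta>) (at_left \<delta>)"
    using continuous_binomial_tail[of UNIV N "DIM('x)"] by (auto simp: continuous_on_def intro: tendsto_within_subset)
  moreover have "\<forall>\<^sub>F t in at_left \<delta>. measure (iid N Q) {s \<in> space (iid N Q). \<delta> \<le> V s} \<le> binomial_tail N DIM('x) t"
    using eventually_at_left_real[OF \<delta>(1)] by eventually_elim (use le in auto)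
  ultimately have "measure (iid N Q) {s \<in> space (iid N Q). \<delta> \<le> V s} \<le> binomial_tail N DIM('x) \<delta>"
    by (intro tendsto_lowerbound) auto
  also have "\<dots> \<le> \<beta>" unfolding N by (rule binomial_tail_N_exact_le[OF \<delta> \<beta>(1)])
  finally show ?thesis unfolding V_def .
qed

lemma sets_chance_feasible:
  assumes "prob_space Q" "sets Q = sets borel" "1 \<le> m"
  shows "{s \<in> space (iid m borel). sol m s \<in> chance_feasible X Xc Q \<epsilon>} \<in> sets (iid m borel)"
proof -
  have "sol m s \<in> X" for s using sol_in_region[OF assms(3), of s] by (simp add: sampled_region_def)
  then have "{s \<in> space (iid m borel). sol m s \<in> chance_feasible X Xc Q \<epsilon>}
     = {s \<in> space (iid m borel). 1 - \<epsilon> \<le> measure Q {\<xi> \<in> space Q. sol m s \<in> Xc \<xi>}}"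
    by (auto simp: chance_feasible_def)
  also have "\<dots> \<in> sets (iid m borel)" using measurable_satisfaction_sol[OF assms] by measurable
  finally show ?thesis .
qed

text \<open>If the solution violates the chance constraint under \<open>R\<close>, its violation
  probability under \<open>Q\<close> is at least \<delta> by duality, and the scenario bound gives
  this event probability at most \<beta>.\<close>

lemma robust_scenario_bound:
  assumes Q: "prob_space Q" "sets Q = sets borel" and R: "prob_space R" "sets R = sets borel"
    and ac: "absolutely_continuous Q R" and div: "phi_div \<phi> Q R \<le> ennreal l" "0 \<le> l" and \<phi>: "\<phi> 1 = 0"
    and \<epsilon>: "\<epsilon> < 1" and \<beta>: "0 < \<beta>" "\<beta> < 1"
    and \<delta>: "\<delta> = eps_adjusted \<epsilon> l \<phi>" "0 < \<delta>" and N: "N = N_exact \<delta> \<beta> DIM('x)"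
  shows "1 - \<beta> \<le> measure (iid N Q) {s \<in> space (iid N borel). sol N s \<in> chance_feasible X Xc R \<epsilon>}"
proof -
  interpret I: prob_space "iid N Q" using Q by (intro prob_space_iid)
  interpret R: prob_space R by fact
  have \<delta>1: "\<delta> \<le> 1" unfolding \<delta>(1) using \<phi> \<epsilon> div by (intro eps_adjusted_le_1) auto
  have "DIM('x) \<le> N" unfolding N by (rule dim_le_N_exact[OF \<delta>(2) \<delta>1 \<beta>])
  then have N1: "1 \<le> N" using DIM_positive[where 'a = 'x] by linarith
  have sp: "space R = space Q" using sets_eq_imp_space_eq Q R by metis
  have spI: "space (iid N Q) = space (iid N borel)" by (intro sets_eq_imp_space_eq sets_iid Q)
  let ?G = "{s \<in> space (iid N borel). sol N s \<in> chance_feasible X Xc R \<epsilon>}"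
  let ?B = "{s \<in> space (iid N Q). \<delta> \<le> measure Q {\<xi> \<in> space Q. sol N s \<notin> Xc \<xi>}}"
  have G: "?G \<in> sets (iid N Q)"
    using sets_chance_feasible[OF R N1, of \<epsilon>] sets_iid[OF Q(2), of N] by simp
  have Bm: "(\<lambda>s. measure Q {\<xi> \<in> space Q. sol N s \<notin> Xc \<xi>}) \<in> borel_measurable (iid N Q)"
    unfolding prob_violation[OF Q]
    using measurable_satisfaction_sol[OF Q N1] sets_iid[OF Q(2), of N] measurable_cong_sets by fastforce
  then have B: "?B \<in> sets (iid N Q)" by measurable
  have "space (iid N Q) - ?G \<subseteq> ?B"
  proof
    fix s assume s: "s \<in> space (iid N Q) - ?G"
    have "sol N s \<in> X" using sol_in_region[OF N1, of s] by (simp add: sampled_region_def)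
    then have "measure R {\<xi> \<in> space R. sol N s \<in> Xc \<xi>} < 1 - \<epsilon>"
      using s by (auto simp: chance_feasible_def spI)
    then have "\<epsilon> < measure R {\<xi> \<in> space Q. sol N s \<notin> Xc \<xi>}"
      using prob_violation[OF R, of "sol N s"] by (simp add: sp)
    then have "\<delta> \<le> measure Q {\<xi> \<in> space Q. sol N s \<notin> Xc \<xi>}"
      unfolding \<delta>(1)
    proof (rule eps_adjusted_le_measure[OF Q(1) R(1) _ ac div \<phi>, rotated 2])
      show "{\<xi> \<in> space Q. sol N s \<notin> Xc \<xi>} \<in> sets Q"
        by (rule sets.sets_Collect_neg[OF measurable_satisfaction(2)[OF Q Xc_measurable]])
      show "sets R = sets Q" using Q R by simp
    qed
    then show "s \<in> ?B" using s by simp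
  qed
  then have "measure (iid N Q) (space (iid N Q) - ?G) \<le> measure (iid N Q) ?B"
    using B by (intro I.finite_measure_mono)
  also have "\<dots> \<le> \<beta>" by (rule scenario_bound[OF Q \<delta>(2) \<delta>1 \<beta> N])
  finally show ?thesis using I.prob_compl[OF G] by simp
qed

end

theorem corollary3p2p2:
  fixes X :: "(real^'d) set"
    and Xc :: "real^'k \<Rightarrow> (real^'d) set"
    and c :: "real^'d"
    and \<epsilon> \<alpha> \<beta> :: real
    and \<phi> :: "real \<Rightarrow> real"
    and \<Theta> :: "(real^'p) set"
    and P :: "real^'p \<Rightarrow> (real^'k) measure"
    and \<mu> :: "(real^'k) measure"
    and p :: "real^'p \<Rightarrow> real^'k \<Rightarrow> real"
    and \<theta>true :: "real^'p"
    and \<theta>hat :: "nat \<Rightarrow> (nat \<Rightarrow> real^'k) \<Rightarrow> real^'p"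
    and \<delta> :: "nat \<Rightarrow> real"
    and N :: "nat \<Rightarrow> nat"
  assumes eps: "0 < \<epsilon>" "\<epsilon> < 1"
    and alpha: "0 < \<alpha>" "\<alpha> < 1"
    and beta: "0 < \<beta>" "\<beta> < 1"
    (* the optimization problem *)
    and Xc_sub: "\<And>\<xi>. Xc \<xi> \<subseteq> X"
    and Xc_convex: "\<And>\<xi>. convex (Xc \<xi>)"
    and sampled_interior:
      "\<And>m s. 1 \<le> m \<Longrightarrow> interior (sampled_region X Xc m s) \<noteq> {}"
    and sampled_unique:
      "\<And>m s. 1 \<le> m \<Longrightarrow> \<exists>!x. is_arg_min (\<lambda>x. c \<bullet> x) (\<lambda>x. x \<in> sampled_region X Xc m s) x"
    and Xc_measurable: "{(x, \<xi>). x \<in> Xc \<xi>} \<in> sets (borel \<Otimes>\<^sub>M borel)"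
    and solution_measurable:
      "\<And>m. 1 \<le> m \<Longrightarrow> sampled_solution c X Xc m \<in> measurable (iid m borel) borel"
    (* the parametric family and its likelihood *)
    and P_kernel: "P \<in> measurable (restrict_space borel \<Theta>) (prob_algebra borel)"
    and mu: "sigma_finite_measure \<mu>" "sets \<mu> = sets borel"
    and p_measurable: "\<And>\<theta>. \<theta> \<in> \<Theta> \<Longrightarrow> p \<theta> \<in> borel_measurable borel"
    and p_nonneg: "\<And>\<theta> \<xi>. \<theta> \<in> \<Theta> \<Longrightarrow> 0 \<le> p \<theta> \<xi>"
    and P_density: "\<And>\<theta>. \<theta> \<in> \<Theta> \<Longrightarrow> P \<theta> = density \<mu> (\<lambda>\<xi>. ennreal (p \<theta> \<xi>))"
    and theta_true: "\<theta>true \<in> \<Theta>"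
    (* the maximum likelihood estimator *)
    and mle_measurable: "\<And>n. \<theta>hat n \<in> measurable (iid n borel) (restrict_space borel \<Theta>)"
    and mle: "\<forall>\<^sub>F n in sequentially. AE \<xi> in iid n (P \<theta>true). is_mle p \<Theta> n \<xi> (\<theta>hat n \<xi>)"
    and fisher_exists: "\<And>\<theta>. \<theta> \<in> \<Theta> \<Longrightarrow> has_fisher_information P p \<Theta> \<theta>"
    and fisher_invertible: "\<And>\<theta>. \<theta> \<in> \<Theta> \<Longrightarrow> invertible (fisher_information P p \<Theta> \<theta>)"
    and fisher_continuous:
      "continuous_on \<Theta> (\<lambda>\<theta>. matrix_inv (fisher_information P p \<Theta> \<theta>))"
    and mle_consistent: "conv_in_probability (\<lambda>n. iid n (P \<theta>true)) \<theta>hat \<theta>true"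
    and mle_normal:
      "conv_in_distribution (\<lambda>n. iid n (P \<theta>true))
         (\<lambda>n \<xi>. sqrt (real n) *\<^sub>R (\<theta>hat n \<xi> - \<theta>true))
         (centred_normal (matrix_inv (fisher_information P p \<Theta> \<theta>true)))"
    (* the divergence and the asymptotic coverage of the uncertainty set *)
    and phi: "phi_generator \<phi>"
    and coverage:
      "(\<lambda>n. measure (iid n (P \<theta>true))
          {\<xi> \<in> space (iid n (P \<theta>true)). P \<theta>true \<in> U_data \<phi> \<alpha> n P \<Theta> (\<theta>hat n \<xi>)})
        \<longlonglongrightarrow> 1 - \<alpha>"
    (* the Monte Carlo step *)
    and mle_density:
      "\<forall>\<^sub>F n in sequentially. AE \<xi> in iid n (P \<theta>true).
         \<exists>f\<in>borel_measurable lborel. P (\<theta>hat n \<xi>) = density lborel f"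
    and delta_def: "\<And>n. \<delta> n = eps_adjusted \<epsilon> (div_radius \<phi> \<alpha> CARD('p) n) \<phi>"
    and delta_pos: "\<forall>\<^sub>F n in sequentially. 0 < \<delta> n"
    and N_def: "\<And>n. N n = N_exact (\<delta> n) \<beta> CARD('d)"
  shows "liminf (\<lambda>n.
           let L = data_mc_law n (N n) (P \<theta>true) (\<lambda>\<xi>. P (\<theta>hat n \<xi>))
           in ereal (measure L {w \<in> space L.
                sampled_solution c X Xc (N n) (snd w) \<in> chance_feasible X Xc (P \<theta>true) \<epsilon>}))
         \<ge> ereal (1 - \<alpha> - \<beta>)"
proof -
  interpret sampled_problem X Xc c
    by unfold_locales (fact Xc_sub Xc_convex sampled_interior sampled_unique Xc_measurable solution_measurable)+
  let ?D = "\<lambda>n. iid n (P \<theta>true)"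
  let ?G = "\<lambda>n s. sampled_solution c X Xc (N n) s \<in> chance_feasible X Xc (P \<theta>true) \<epsilon>"
  let ?L = "\<lambda>n. data_mc_law n (N n) (P \<theta>true) (\<lambda>\<xi>. P (\<theta>hat n \<xi>))"
  let ?g = "\<lambda>n. measure (?L n) {w \<in> space (?L n). ?G n (snd w)}"
  define A where "A n = {\<xi> \<in> space (?D n). P \<theta>true \<in> U_data \<phi> \<alpha> n P \<Theta> (\<theta>hat n \<xi>)}" for n
  have P: "prob_space (P \<theta>)" "sets (P \<theta>) = sets borel" if "\<theta> \<in> \<Theta>" for \<theta>
    using measurable_space[OF P_kernel, of \<theta>] that by (auto simp: space_prob_algebra space_restrict_space)
  have kernel: "(\<lambda>\<xi>. P (\<theta>hat n \<xi>)) \<in> measurable (iid n borel) (prob_algebra borel)" for n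
    by (rule measurable_compose[OF mle_measurable P_kernel])
  have \<phi>1: "\<phi> 1 = 0" using phi by (simp add: phi_generator_def)
  have lim: "(\<lambda>n. measure (?D n) (A n)) \<longlonglongrightarrow> 1 - \<alpha>" unfolding A_def by (rule coverage)
  have "\<forall>\<^sub>F n in sequentially. 0 < measure (?D n) (A n)"
    by (rule order_tendstoD(1)[OF lim]) (use alpha in simp)
  \<comment> \<open>For data in \<open>A n\<close> the Monte Carlo step succeeds with conditional
    probability at least \<open>1 - \<beta>\<close>.\<close>
  with delta_pos have "\<forall>\<^sub>F n in sequentially. (1 - \<beta>) * measure (?D n) (A n) \<le> ?g n"
  proof eventually_elim
    case (elim n)
    have "1 \<le> N n"
    proof -
      have "\<delta> n \<le> 1" unfolding delta_def
        using \<phi>1 eps div_radius_nonneg[OF phi alpha] by (intro eps_adjusted_le_1) auto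
      then have "CARD('d) \<le> N n" unfolding N_def using elim beta by (intro dim_le_N_exact) auto
      then show ?thesis using zero_less_card_finite[where 'a = 'd] by linarith
    qed
    show ?case
    proof (rule data_mc_law_lower_bound[OF P[OF theta_true] kernel])
      \<comment> \<open>A set of positive measure is measurable, since \<open>measure\<close> is 0 elsewhere.\<close>
      show "A n \<in> sets (?D n)" using elim(2) by (metis less_irrefl measure_notin_sets)
      show "{s \<in> space (iid (N n) borel). ?G n s} \<in> sets (iid (N n) borel)"
        by (rule sets_chance_feasible[OF P[OF theta_true] \<open>1 \<le> N n\<close>])
      fix \<xi> assume \<xi>: "\<xi> \<in> A n"
      have "\<xi> \<in> space (iid n borel)"
        using \<xi> sets_eq_imp_space_eq[OF sets_iid[OF P(2)[OF theta_true]]] by (auto simp: A_def)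
      then have th: "\<theta>hat n \<xi> \<in> \<Theta>"
        using measurable_space[OF mle_measurable] by (auto simp: space_restrict_space)
      show "1 - \<beta> \<le> measure (iid (N n) (P (\<theta>hat n \<xi>))) {s \<in> space (iid (N n) borel). ?G n s}"
        by (rule robust_scenario_bound[OF P[OF th] P[OF theta_true] _ _ div_radius_nonneg[OF phi alpha] \<phi>1 eps(2) beta delta_def])
           (use \<xi> elim in \<open>auto simp: A_def U_data_def N_def\<close>)
    qed (use beta in simp)
  qed
  then have "liminf (\<lambda>n. ereal ((1 - \<beta>) * measure (?D n) (A n))) \<le> liminf (\<lambda>n. ereal (?g n))"
    by (intro Liminf_mono) (auto elim: eventually_mono)
  moreover have "liminf (\<lambda>n. ereal ((1 - \<beta>) * measure (?D n) (A n))) = ereal ((1 - \<beta>) * (1 - \<alpha>))"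
    using lim by (intro lim_imp_Liminf tendsto_ereal tendsto_mult_left) auto
  ultimately have "ereal ((1 - \<beta>) * (1 - \<alpha>)) \<le> liminf (\<lambda>n. ereal (?g n))"
    by simp
  \<comment> \<open>Conditioning yields the product of the confidence levels, which exceeds the
    claimed one by \<open>\<alpha> * \<beta>\<close>.\<close>
  moreover have "1 - \<alpha> - \<beta> \<le> (1 - \<beta>) * (1 - \<alpha>)"
    using alpha beta mult_nonneg_nonneg[of \<alpha> \<beta>] by (simp add: algebra_simps)
  then have "ereal (1 - \<alpha> - \<beta>) \<le> ereal ((1 - \<beta>) * (1 - \<alpha>))"
    by simp
  ultimately show ?thesis
    unfolding Let_def by (rule order_trans[rotated])
qed

end
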